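(* Let $0 \le \alpha < 1$, let $f \in S^*(\alpha)$, and for $|w| < \frac14$ let $$f^{-1}(w) = w + \sum_{n=2}^{\infty} A_n w^n .$$ Then, for every integer $n \ge 2$: (a) if $\alpha \in I_0(n) \cup I_1(n)$, then $$|A_n| \le \frac{\Gamma(2n(1-\alpha)+1)}{\Gamma(n+1)\,\Gamma(2n(1-\alpha)+2-n)};$$ (b) if $\alpha \in I_k(n)$ for some $k \in \{2,\dots,n-2\}$, then $$|A_n| \le \frac{\Gamma(2n(1-\alpha)+1)}{n(n-1)\,\Gamma(n-k)\,\Gamma(2n(1-\alpha)+1+k-n)};$$ (c) if $\alpha \in I_{n-1}(n)$, then $$|A_n| \le \frac{2(1-\alpha)}{n-1}.$$ The estimates in (a) and (c) are sharp: for every $n \ge 2$ and every $\alpha$ in the range indicated in (a) (respectively (c)), there is a function $f \in S^*(\alpha)$ for which equality holds in the estimate of (a) (respectively (c)).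
   Context: Let $D = \{z \in \mathbb{C} : |z| < 1\}$. For $0 \le \alpha < 1$, $S^*(\alpha)$ (starlike functions of order $\alpha$) is the class of functions $f$ analytic in $D$ with power series $f(z) = z + \sum_{n=2}^\infty a_n z^n$ such that $\operatorname{Re}\left(\frac{z f'(z)}{f(z)}\right) > \alpha$ for all $z \in D$ (with $zf'(z)/f(z)$ taken to be $1$ at $z=0$). Such functions are univalent in $D$, and $f^{-1}$ denotes the inverse function, analytic in a neighbourhood of $0$ containing $|w|<\frac14$, with $f^{-1}(0)=0$. For an integer $n \ge 1$ and $k = 0,1,\dots,n-1$, $I_k(n)$ denotes the half-open interval $\left[\frac{k}{n}, \frac{k+1}{n}\right)$. $\Gamma$ is the Gamma function. *)

theory Defs
  imports "HOL-Complex_Analysis.Complex_Analysis"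
begin

text \<open>
  Starlike functions of order \<open>\<alpha>\<close>, normalised by \<open>f(z) = z + a\<^sub>2 z\<^sup>2 + \<dots>\<close>.
  For \<open>0 \<le> \<alpha>\<close>, which is the only range in which the class is used, the inequality also
  forces \<open>f z \<noteq> 0\<close> for \<open>z \<noteq> 0\<close>, since the quotient is \<open>0\<close> when its denominator vanishes.
\<close>

definition starlike_of_order :: "real \<Rightarrow> (complex \<Rightarrow> complex) set" where
  "starlike_of_order \<alpha> =
     {f. f holomorphic_on ball 0 1 \<and> f 0 = 0 \<and> deriv f 0 = 1 \<and>
         (\<forall>z\<in>ball 0 1. Re (if z = 0 then 1 else z * deriv f z / f z) > \<alpha>)}"

text \<open>
  \<open>f\<^sup>-\<^sup>1(w) = w + (\<Sum>n\<ge>2. A n * w\<^sup>n)\<close> for \<open>|w| < 1/4\<close>, where \<open>f\<^sup>-\<^sup>1\<close> is the inverse of \<open>f\<close>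
  restricted to the unit disc. The values \<open>A 0\<close> and \<open>A 1\<close> play no role.
\<close>

definition inverse_expansion :: "(complex \<Rightarrow> complex) \<Rightarrow> (nat \<Rightarrow> complex) \<Rightarrow> bool" where
  "inverse_expansion f A \<longleftrightarrow>
     (\<forall>w\<in>ball 0 (1/4).
        (\<lambda>n. A (n + 2) * w ^ (n + 2)) sums (the_inv_into (ball 0 1) f w - w))"

definition I_interval :: "nat \<Rightarrow> nat \<Rightarrow> real set" where
  "I_interval k n = {real k / real n ..< (real k + 1) / real n}"

end

theory Submission
  imports Defs
begin

text \<open>
  Write \<open>f(z) = z e(z)\<close> and \<open>h = e\<^bsup>-n\<^esup> = (z/f)\<^sup>n = \<Sum> h\<^sub>j z\<^sup>j\<close>. Lagrange inversion gives
  \<open>n A\<^sub>n = h\<^bsub>n-1\<^esub>\<close>. With \<open>\<beta> = 2n(1-\<alpha>)\<close>, starlikeness of order \<open>\<alpha>\<close> says that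
  \<open>z h' = \<omega> (\<beta> h - z h')\<close> for some holomorphic \<open>\<omega>\<close> with \<open>\<omega>(0) = 0\<close> and \<open>|\<omega>| \<le> 1\<close>, so Clunie's method
  yields \<open>m\<^sup>2 |h\<^sub>m|\<^sup>2 \<le> \<Sum>\<^bsub>j<m\<^esub> \<beta>(\<beta> - 2j) |h\<^sub>j|\<^sup>2\<close>. The weights change sign at \<open>j = n(1-\<alpha>)\<close>;
  dropping the nonpositive ones and using that the binomial coefficients of \<open>\<beta>\<close> satisfy this
  recursion with equality, one gets \<open>m |h\<^sub>m| \<le> N (\<beta> choose N)\<close>, where \<open>N\<close> is the number of positive
  weights with \<open>j < m\<close>. The extremal functions are \<open>z (1 - z\<^sup>m)\<^bsup>-2(1-\<alpha>)/m\<^esup>\<close>, for which \<open>\<omega> = -z\<^sup>m\<close>, with \<open>m = 1\<close>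
  for (a) and \<open>m = n - 1\<close> for (c).
\<close>

section \<open>Lagrange inversion for formal power series\<close>

text \<open>With \<open>F = fps_X * E\<close> and \<open>V = inverse E\<close>, the power
  \<open>V ^ n\<close> stands for \<open>X^n / F^n\<close>, so coefficient \<open>n - 1\<close> of
  \<open>V ^ n * Y\<close> is the formal residue of \<open>Y / F^n\<close>. Differentiating
  \<open>B oo F = fps_X\<close> and taking residues isolates the term \<open>j = n\<close>, because
  every other \<open>F^(j-n-1) F'\<close> is an exact derivative.\<close>

lemma fps_lagrange_inversion:
  fixes B E :: "'a::field_char_0 fps"
  assumes E0: "fps_nth E 0 \<noteq> 0" and inv: "B oo (fps_X * E) = fps_X" and n: "n \<ge> 1"
  shows "of_nat n * fps_nth B n = fps_nth (inverse E ^ n) (n - 1)"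
proof -
  define V where "V = inverse E"
  define F where "F = fps_X * E"
  have VE: "V * E = 1" and F0: "fps_nth F 0 = 0"
    using E0 by (simp_all add: V_def F_def inverse_mult_eq_1)
  have E': "fps_deriv V = - (V\<^sup>2 * fps_deriv E)"
    using fps_inverse_deriv[OF E0] by (simp add: V_def mult.commute)
  have F': "fps_deriv F = E + fps_X * fps_deriv E"
    by (simp add: F_def add.commute)
  \<comment> \<open>Cancelling \<open>V * E = 1\<close> in advance leaves only powers of
    \<open>V\<close> with natural exponents, so the residue argument needs no Laurent
    series.\<close>
  have main: "V ^ n * fps_deriv (F ^ j) = 
      fps_const (of_nat j) * (fps_X ^ (j - 1) * (V ^ (n - j) + fps_X * (V ^ (n - j + 1) * fps_deriv E)))"
    if j: "1 \<le> j" "j \<le> n" for j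
  proof -
    have n_eq: "V ^ n = V ^ (n - j + 1) * V ^ (j - 1)"
    proof -
      have "n = (n - j + 1) + (j - 1)" using j by simp
      then show ?thesis by (metis power_add)
    qed
    have VF: "V ^ (j - 1) * F ^ (j - 1) = fps_X ^ (j - 1)"
    proof -
      have "V * F = fps_X" using VE by (simp add: F_def mult.left_commute)
      then show ?thesis by (metis power_mult_distrib)
    qed
    have VEj: "V ^ (n - j + 1) * E = V ^ (n - j)" 
      using VE by (simp add: mult.assoc mult.left_commute[of V])
    have "V ^ n * fps_deriv (F ^ j) = fps_const (of_nat j) * ((V ^ (j-1) * F ^ (j - 1)) * (V ^ (n - j + 1) * fps_deriv F))"
      unfolding fps_deriv_power n_eq by (simp add: mult_ac)
    also have "V ^ (n - j + 1) * fps_deriv F = V ^ (n - j) + fps_X * (V ^ (n - j + 1) * fps_deriv E)"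
      unfolding F' distrib_left VEj by (simp add: mult_ac)
    finally show ?thesis by (simp only: VF)
  qed
  have coeff: "fps_nth (V ^ n * fps_deriv (F ^ j)) (n - 1) = (if j = n then of_nat n else 0)"
    if j: "1 \<le> j" "j \<le> n" for j
  proof -
    have sh: "fps_nth (fps_X ^ (j - 1) * Y) (n - 1) = fps_nth Y (n - j)" for Y :: "'a fps"
      using j by (simp add: fps_X_power_mult_nth)
    have "fps_nth (V ^ n * fps_deriv (F ^ j)) (n - 1) = of_nat j * (fps_nth (V ^ (n - j)) (n - j) + 
            fps_nth (fps_X * (V ^ (n - j + 1) * fps_deriv E)) (n - j))"
      unfolding main[OF j] by (simp only: fps_mult_left_const_nth sh fps_add_nth)
    also have "\<dots> = (if j = n then of_nat n else 0)"
    proof (cases "j = n")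
      case False
      define k where "k = n - j"
      have k: "k > 0" using False j by (simp add: k_def)
      \<comment> \<open>Two evaluations of coefficient \<open>k\<close> of
        \<open>fps_X * fps_deriv (V ^ k)\<close>: directly it is \<open>k\<close> times that of
        \<open>V ^ k\<close>, by the chain rule it is \<open>-k\<close> times the second summand.
        Hence the two summands cancel; this is the vanishing residue of a derivative.\<close>
      have "fps_deriv (V ^ k) = fps_const (of_nat k) * fps_deriv V * V ^ (k - 1)"
        by (simp add: fps_deriv_power)
      also have "\<dots> = - (fps_const (of_nat k) * (V ^ (k + 1) * fps_deriv E))"
        using k by (cases k) (simp_all add: E' power2_eq_square mult_ac)
      finally have "fps_nth (fps_X * fps_deriv (V ^ k)) k = - (of_nat k * fps_nth (fps_X * (V ^ (k + 1) * fps_deriv E)) k)"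
        using k by simp
      moreover have "fps_nth (fps_X * fps_deriv (V ^ k)) k = of_nat k * fps_nth (V ^ k) k"
        using k by simp
      ultimately have "of_nat k * (fps_nth (V ^ k) k + fps_nth (fps_X * (V ^ (k + 1) * fps_deriv E)) k) = 0"
        by (metis add.left_inverse distrib_left)
      then show ?thesis using False k by (simp add: k_def)
    qed (simp)
    finally show ?thesis .
  qed
  \<comment> \<open>The tail of \<open>B\<close> beyond degree \<open>n\<close>. After composition
    it carries \<open>F ^ Suc n\<close>, its derivative still carries \<open>F ^ n\<close>, and
    \<open>V ^ n\<close> turns this into \<open>fps_X ^ n\<close>, which is invisible at coefficient
    \<open>n - 1\<close>. Only a finite sum remains.\<close>
  define R where "R = fps_shift (Suc n) B"
  have dec: "B = (\<Sum>j\<le>n. fps_const (fps_nth B j) * fps_X ^ j) + fps_X ^ Suc n * R"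
  proof (rule fps_ext)
    fix i
    show "fps_nth B i = fps_nth ((\<Sum>j\<le>n. fps_const (fps_nth B j) * fps_X ^ j) + fps_X ^ Suc n * R) i"
      unfolding fps_add_nth fps_sum_nth fps_mult_left_const_nth fps_X_power_nth fps_X_power_mult_nth
      by (auto simp: R_def if_distrib cong: if_cong)
  qed
  have "fps_X = (\<Sum>j\<le>n. fps_const (fps_nth B j) * F ^ j) + F ^ Suc n * (R oo F)"
  proof -
    have "fps_X = B oo F" using inv by (simp add: F_def)
    also have "\<dots> = ((\<Sum>j\<le>n. fps_const (fps_nth B j) * fps_X ^ j) + fps_X ^ Suc n * R) oo F"
      using dec by simp
    also have "\<dots> = (\<Sum>j\<le>n. fps_const (fps_nth B j) * F ^ j) + F ^ Suc n * (R oo F)"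
      using F0 by (simp only: fps_compose_add_distrib fps_compose_sum_distrib fps_compose_mult_distrib
        fps_compose_power[symmetric] fps_const_compose fps_X_fps_compose_startby0)
    finally show ?thesis .
  qed
  then have "fps_deriv fps_X = fps_deriv (\<Sum>j\<le>n. fps_const (fps_nth B j) * F ^ j) + fps_deriv (F ^ Suc n * (R oo F))"
    by (metis fps_deriv_add)
  moreover have "fps_deriv (\<Sum>j\<le>n. fps_const (fps_nth B j) * F ^ j) = (\<Sum>j\<le>n. fps_const (fps_nth B j) * fps_deriv (F ^ j))"
    by (simp add: fps_deriv_sum)
  moreover have "fps_deriv (F ^ Suc n * (R oo F)) = F ^ n * (fps_const (of_nat (Suc n)) * fps_deriv F * (R oo F) + F * fps_deriv (R oo F))"
    by (simp only: fps_deriv_mult fps_deriv_power) (simp add: algebra_simps)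
  moreover define K where "K = fps_const (of_nat (Suc n)) * fps_deriv F * (R oo F) + F * fps_deriv (R oo F)"
  ultimately have one: "1 = (\<Sum>j\<le>n. fps_const (fps_nth B j) * fps_deriv (F ^ j)) + F ^ n * K"
    by simp
  have "V ^ n = V ^ n * ((\<Sum>j\<le>n. fps_const (fps_nth B j) * fps_deriv (F ^ j)) + F ^ n * K)"
    by (simp only: one[symmetric] mult_1_right)
  also have "\<dots> = (\<Sum>j\<le>n. fps_const (fps_nth B j) * (V ^ n * fps_deriv (F ^ j))) + fps_X ^ n * K"
  proof -
    have "V * F = fps_X" using VE by (simp add: F_def mult.left_commute)
    then have "V ^ n * F ^ n = fps_X ^ n" by (metis power_mult_distrib)
    then show ?thesis
      by (simp only: distrib_left sum_distrib_left mult.left_commute[of "V ^ n" "fps_const c" for c] flip: mult.assoc[of "V ^ n" "F ^ n"])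
  qed
  finally have "fps_nth (V ^ n) (n - 1) = (\<Sum>j\<le>n. fps_nth B j * fps_nth (V ^ n * fps_deriv (F ^ j)) (n - 1)) + fps_nth (fps_X ^ n * K) (n - 1)"
    by (metis (no_types, lifting) fps_add_nth fps_sum_nth fps_mult_left_const_nth sum.cong)
  also have "fps_nth (fps_X ^ n * K) (n - 1) = 0"
    using n by (simp add: fps_X_power_mult_nth)
  also have "(\<Sum>j\<le>n. fps_nth B j * fps_nth (V ^ n * fps_deriv (F ^ j)) (n - 1)) = (\<Sum>j\<le>n. if j = n then of_nat n * fps_nth B n else 0)"
  proof (rule sum.cong[OF refl])
    fix j assume "j \<in> {..n}"
    then show "fps_nth B j * fps_nth (V ^ n * fps_deriv (F ^ j)) (n - 1) = (if j = n then of_nat n * fps_nth B n else 0)"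
      using coeff[of j] n by (cases "j = 0") (auto simp: mult.commute)
  qed
  finally show ?thesis by (simp add: V_def)
qed

section \<open>The recursive inequality and binomial coefficients\<close>

text \<open>The sum telescopes: \<open>(m + 1)\<close> times the next binomial coefficient is
  \<open>\<beta> - m\<close> times the current one, and
  \<open>(\<beta> - m)^2 - m^2 = \<beta>(\<beta> - 2m)\<close>.\<close>

lemma sum_gbinomial_squares:
  fixes \<beta> :: real
  shows "(\<Sum>j<m. \<beta> * (\<beta> - 2 * real j) * (\<beta> gchoose j)\<^sup>2) = (real m * (\<beta> gchoose m))\<^sup>2"
proof (induction m)
  case (Suc m)
  have "real (Suc m) * (\<beta> gchoose Suc m) = (\<beta> - real m) * (\<beta> gchoose m)"
    using gbinomial_absorption[of m \<beta>] gbinomial_absorb_comp[of \<beta> m] by simp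
  then have "(real (Suc m) * (\<beta> gchoose Suc m))\<^sup>2 = ((\<beta> - real m) * (\<beta> gchoose m))\<^sup>2"
    by simp
  moreover have "(\<Sum>j<Suc m. \<beta> * (\<beta> - 2 * real j) * (\<beta> gchoose j)\<^sup>2) = 
      (real m * (\<beta> gchoose m))\<^sup>2 + \<beta> * (\<beta> - 2 * real m) * (\<beta> gchoose m)\<^sup>2"
    using Suc by simp
  ultimately show ?case by (simp only:) (simp add: algebra_simps power2_eq_square)
qed simp

text \<open>A bound on \<open>h j\<close> may be inserted only where its weight is nonnegative, so
  the induction runs over \<open>j < N\<close>, and the terms from \<open>N\<close> to
  \<open>m - 1\<close> are dropped as nonpositive. What is left is the recursion for index
  \<open>N\<close> itself, hence a right-hand side free of \<open>m\<close>.\<close>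

lemma clunie_recursion_bound:
  fixes h :: "nat \<Rightarrow> real" and \<beta> :: real
  assumes h0: "h 0 = 1" and nonneg: "\<And>j. h j \<ge> 0"
    and rec: "\<And>m. (real m * h m)\<^sup>2 \<le> (\<Sum>j<m. \<beta> * (\<beta> - 2 * real j) * (h j)\<^sup>2)"
    and \<beta>: "\<beta> \<ge> 2 * (real N - 1)" and N: "1 \<le> N" "N \<le> m"
    and above: "\<And>j. N \<le> j \<Longrightarrow> j < m \<Longrightarrow> \<beta> \<le> 2 * real j"
  shows "real m * h m \<le> real N * (\<beta> gchoose N)"
proof -
  have \<beta>0: "\<beta> \<ge> 0" using \<beta> N by simp
  have pos: "\<beta> * (\<beta> - 2 * real j) \<ge> 0" if "j < N" for j
    using \<beta> \<beta>0 that by (intro mult_nonneg_nonneg) auto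
  \<comment> \<open>Since \<open>\<beta> \<ge> 2(N - 1) \<ge> N - 1\<close>, all factors
    \<open>\<beta> - i\<close> with \<open>i < N\<close> are nonnegative. The sign is what allows
    square roots to be taken below.\<close>
  have gpos: "(\<beta> gchoose j) \<ge> 0" if "j \<le> N" for j
  proof -
    have "(\<Prod>i = 0..<j. \<beta> - real i) \<ge> 0"
      using \<beta> that N by (intro prod_nonneg) auto
    then show ?thesis by (simp add: gbinomial_prod_rev)
  qed
  have bound: "h j \<le> \<beta> gchoose j" if "j < N" for j
    using that
  proof (induction j rule: less_induct)
    case (less j)
    show ?case
    proof (cases "j = 0")
      case False
      have "(real j * h j)\<^sup>2 \<le> (\<Sum>i<j. \<beta> * (\<beta> - 2 * real i) * (h i)\<^sup>2)" by (rule rec)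
      also have "\<dots> \<le> (\<Sum>i<j. \<beta> * (\<beta> - 2 * real i) * (\<beta> gchoose i)\<^sup>2)"
        using less nonneg by (intro sum_mono mult_left_mono power_mono pos) auto
      also have "\<dots> = (real j * (\<beta> gchoose j))\<^sup>2" by (rule sum_gbinomial_squares)
      finally have "real j * h j \<le> real j * (\<beta> gchoose j)"
        by (rule power2_le_imp_le) (use gpos[of j] less.prems in simp)
      then show ?thesis using False by (simp only: mult_le_cancel_left_pos of_nat_0_less_iff neq0_conv)
    qed (simp add: h0)
  qed
  have "(real m * h m)\<^sup>2 \<le> (\<Sum>j<m. \<beta> * (\<beta> - 2 * real j) * (h j)\<^sup>2)" by (rule rec)
  also have "{..<m} = {..<N} \<union> {N..<m}" using N by auto
  also have "(\<Sum>j\<in>{..<N} \<union> {N..<m}. \<beta> * (\<beta> - 2 * real j) * (h j)\<^sup>2) = 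
     (\<Sum>j<N. \<beta> * (\<beta> - 2 * real j) * (h j)\<^sup>2) + (\<Sum>j=N..<m. \<beta> * (\<beta> - 2 * real j) * (h j)\<^sup>2)"
    by (intro sum.union_disjoint) auto
  also have "(\<Sum>j=N..<m. \<beta> * (\<beta> - 2 * real j) * (h j)\<^sup>2) \<le> 0"
    using above \<beta>0 by (intro sum_nonpos mult_nonpos_nonneg mult_nonneg_nonpos) auto
  finally have "(real m * h m)\<^sup>2 \<le> (\<Sum>j<N. \<beta> * (\<beta> - 2 * real j) * (h j)\<^sup>2)" by simp
  also have "(\<Sum>j<N. \<beta> * (\<beta> - 2 * real j) * (h j)\<^sup>2) \<le> (\<Sum>j<N. \<beta> * (\<beta> - 2 * real j) * (\<beta> gchoose j)\<^sup>2)"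
    using bound nonneg by (intro sum_mono mult_left_mono power_mono pos) auto
  also have "\<dots> = (real N * (\<beta> gchoose N))\<^sup>2" by (rule sum_gbinomial_squares)
  finally show ?thesis by (rule power2_le_imp_le) (use gpos[of N] in simp)
qed

lemma gbinomial_Gamma_top:
  fixes \<beta> :: real
  assumes "1 \<le> N" "\<beta> > real N - 1"
  shows "real N * (\<beta> gchoose N) = Gamma (\<beta> + 1) / (Gamma (real N) * Gamma (\<beta> - real N + 1))"
proof -
  have "\<beta> + 1 \<notin> \<int>\<^sub>\<le>\<^sub>0" using assms by (auto elim!: nonpos_Ints_cases)
  moreover have "fact N = real N * Gamma (real N)" 
    using assms Gamma_fact[of "N - 1", where 'a = real] fact_reduce[of N] by (simp add: of_nat_diff)
  ultimately show ?thesis using assms by (simp add: gbinomial_Gamma)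
qed

section \<open>Clunie's coefficient inequality\<close>

text \<open>On the circle \<open>cnj z = r^2 / z\<close>, so this is Cauchy's formula for the
  \<open>k\<close>-th coefficient, scaled by \<open>r^(2k)\<close>. The path is parametrised over
  \<open>[0, 1]\<close>, which makes the integral a mean value.\<close>

lemma has_integral_circle_coeff:
  assumes hol: "f holomorphic_on ball 0 1" and r: "0 < r" "r < 1" and F: "f has_fps_expansion F"
  shows "((\<lambda>t. f (circlepath 0 r t) * cnj (circlepath 0 r t) ^ k) has_integral
           of_real (r ^ (2 * k)) * fps_nth F k) {0..1}"
proof -
  let ?\<gamma> = "circlepath 0 r"
  have vd: "vector_derivative ?\<gamma> (at t) = 2 * pi * \<i> * ?\<gamma> t" for t
    by (simp add: vector_derivative_circlepath) (simp add: circlepath)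
  have "((\<lambda>u. f u / (u - 0) ^ Suc k) has_contour_integral
         (2 * pi * \<i>) / fact k * (deriv ^^ k) f 0) ?\<gamma>"
  proof (rule Cauchy_has_contour_integral_higher_derivative_circlepath)
    show "continuous_on (cball 0 r) f"
      using r by (intro holomorphic_on_imp_continuous_on holomorphic_on_subset[OF hol]) auto
    show "f holomorphic_on ball 0 r"
      using r by (intro holomorphic_on_subset[OF hol]) auto
  qed (use r in auto)
  then have "((\<lambda>t. f (?\<gamma> t) / ?\<gamma> t ^ Suc k * (2 * pi * \<i> * ?\<gamma> t)) has_integral
               (2 * pi * \<i>) * fps_nth F k) {0..1}"
    by (simp add: has_contour_integral vd fps_nth_fps_expansion[OF F])
  then have "((\<lambda>t. of_real (r ^ (2 * k)) / (2 * pi * \<i>) * (f (?\<gamma> t) / ?\<gamma> t ^ Suc k * (2 * pi * \<i> * ?\<gamma> t))) has_integral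
               of_real (r ^ (2 * k)) / (2 * pi * \<i>) * ((2 * pi * \<i>) * fps_nth F k)) {0..1}"
    by (rule has_integral_mult_right)
  moreover have "of_real (r ^ (2 * k)) / (2 * pi * \<i>) * (f (?\<gamma> t) / ?\<gamma> t ^ Suc k * (2 * pi * \<i> * ?\<gamma> t))
      = f (?\<gamma> t) * cnj (?\<gamma> t) ^ k" for t
  proof -
    have n: "norm (?\<gamma> t) = r" using r by (simp add: circlepath norm_mult)
    then have nz: "?\<gamma> t \<noteq> 0" using r by auto
    have "?\<gamma> t * cnj (?\<gamma> t) = of_real (r\<^sup>2)" using n by (simp flip: complex_norm_square)
    then have "of_real (r ^ (2 * k)) = ?\<gamma> t ^ k * cnj (?\<gamma> t) ^ k"
      by (simp add: power_mult flip: power_mult_distrib)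
    then show ?thesis using nz by (simp add: field_simps)
  qed
  ultimately show ?thesis by (simp add: mult_ac)
qed

lemma has_integral_circle_cnj_poly:
  assumes hol: "f holomorphic_on ball 0 1" and r: "0 < r" "r < 1" and F: "f has_fps_expansion F"
  shows "((\<lambda>t. f (circlepath 0 r t) * cnj (\<Sum>j\<le>m. a j * circlepath 0 r t ^ j)) has_integral
           (\<Sum>j\<le>m. of_real (r ^ (2 * j)) * (fps_nth F j * cnj (a j)))) {0..1}"
proof -
  have "((\<lambda>t. \<Sum>j\<le>m. cnj (a j) * (f (circlepath 0 r t) * cnj (circlepath 0 r t) ^ j)) has_integral
           (\<Sum>j\<le>m. cnj (a j) * (of_real (r ^ (2 * j)) * fps_nth F j))) {0..1}"
    by (intro has_integral_sum has_integral_mult_right has_integral_circle_coeff assms) auto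
  then show ?thesis by (simp add: sum_distrib_left mult_ac)
qed

lemma poly_sum_has_fps_expansion:
  fixes a :: "nat \<Rightarrow> complex"
  shows "(\<lambda>z. \<Sum>j\<le>m. a j * z ^ j) has_fps_expansion fps_cutoff (Suc m) (Abs_fps a)"
proof -
  have "(\<lambda>z. \<Sum>j\<le>m. a j * z ^ j) has_fps_expansion (\<Sum>j\<le>m. fps_const (a j) * fps_X ^ j)"
    by (intro has_fps_expansion_sum has_fps_expansion_cmult_left has_fps_expansion_fps_X_power)
  also have "(\<Sum>j\<le>m. fps_const (a j) * fps_X ^ j) = fps_cutoff (Suc m) (Abs_fps a)"
    by (rule fps_ext) (auto simp: fps_sum_nth if_distrib cong: if_cong)
  finally show ?thesis .
qed

lemma has_integral_circle_poly_square:
  assumes r: "0 < r" "r < 1"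
  shows "((\<lambda>t. (norm (\<Sum>j\<le>m. a j * circlepath 0 r t ^ j))\<^sup>2) has_integral
           (\<Sum>j\<le>m. r ^ (2 * j) * (norm (a j))\<^sup>2)) {0..1}"
proof -
  have "((\<lambda>t. (\<Sum>j\<le>m. a j * circlepath 0 r t ^ j) * cnj (\<Sum>j\<le>m. a j * circlepath 0 r t ^ j)) has_integral
           (\<Sum>j\<le>m. of_real (r ^ (2 * j)) * (fps_nth (fps_cutoff (Suc m) (Abs_fps a)) j * cnj (a j)))) {0..1}"
    by (rule has_integral_circle_cnj_poly[OF _ r poly_sum_has_fps_expansion]) (intro holomorphic_intros)
  also have "(\<Sum>j\<le>m. of_real (r ^ (2 * j)) * (fps_nth (fps_cutoff (Suc m) (Abs_fps a)) j * cnj (a j))) =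
     of_real (\<Sum>j\<le>m. r ^ (2 * j) * (norm (a j))\<^sup>2)"
    unfolding of_real_sum by (intro sum.cong) (simp_all flip: complex_norm_square)
  finally have "((\<lambda>t. of_real ((norm (\<Sum>j\<le>m. a j * circlepath 0 r t ^ j))\<^sup>2)) has_integral
           complex_of_real (\<Sum>j\<le>m. r ^ (2 * j) * (norm (a j))\<^sup>2)) {0..1}"
    by (simp only: complex_norm_square)
  from has_integral_Re[OF this] show ?thesis by simp
qed

text \<open>The Taylor polynomial \<open>T\<close> of \<open>f\<close> is its \<open>L\<^sup>2\<close> projection on the circle, so
  \<open>\<integral>|f|\<^sup>2 \<ge> 2 Re \<integral>f (cnj T) - \<integral>|T|\<^sup>2 = \<integral>|T|\<^sup>2\<close>.\<close>

lemma sum_coeff_squares_le_of_dominated: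
  assumes hol: "f holomorphic_on ball 0 1" and F: "f has_fps_expansion F"
    and le: "\<And>z. z \<in> ball 0 1 \<Longrightarrow> norm (f z) \<le> norm (\<Sum>j\<le>l. a j * z ^ j)"
  shows "(\<Sum>j\<le>m. (norm (fps_nth F j))\<^sup>2) \<le> (\<Sum>j\<le>l. (norm (a j))\<^sup>2)"
proof -
  have ineq: "(\<Sum>j\<le>m. r ^ (2 * j) * (norm (fps_nth F j))\<^sup>2) \<le> (\<Sum>j\<le>l. (norm (a j))\<^sup>2)"
    if r: "0 < r" "r < 1" for r :: real
  proof -
    let ?\<gamma> = "circlepath 0 r"
    define T where "T = (\<lambda>z. \<Sum>j\<le>m. fps_nth F j * z ^ j)"
    define S where "S = (\<Sum>j\<le>m. r ^ (2 * j) * (norm (fps_nth F j))\<^sup>2)"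
    have "((\<lambda>t. f (?\<gamma> t) * cnj (T (?\<gamma> t))) has_integral complex_of_real S) {0..1}"
      using has_integral_circle_cnj_poly[OF hol r F, where m = m and a = "fps_nth F"]
      by (simp add: T_def S_def flip: complex_norm_square)
    from has_integral_Re[OF this]
    have 1: "((\<lambda>t. Re (f (?\<gamma> t) * cnj (T (?\<gamma> t)))) has_integral S) {0..1}" by (simp del: times_complex.sel)
    have 2: "((\<lambda>t. (norm (T (?\<gamma> t)))\<^sup>2) has_integral S) {0..1}"
      unfolding T_def S_def by (rule has_integral_circle_poly_square[OF r])
    have 3: "((\<lambda>t. 2 * Re (f (?\<gamma> t) * cnj (T (?\<gamma> t))) - (norm (T (?\<gamma> t)))\<^sup>2) has_integral 2 * S - S) {0..1}"
      by (intro has_integral_diff has_integral_mult_right 1 2)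
    have 4: "((\<lambda>t. (norm (\<Sum>j\<le>l. a j * ?\<gamma> t ^ j))\<^sup>2) has_integral
           (\<Sum>j\<le>l. r ^ (2 * j) * (norm (a j))\<^sup>2)) {0..1}"
      by (rule has_integral_circle_poly_square[OF r])
    have "2 * S - S \<le> (\<Sum>j\<le>l. r ^ (2 * j) * (norm (a j))\<^sup>2)"
    proof (rule has_integral_le[OF 3 4])
      fix t :: real
      have "norm (?\<gamma> t) = r" using r by (simp add: circlepath norm_mult)
      then have "norm (f (?\<gamma> t)) \<le> norm (\<Sum>j\<le>l. a j * ?\<gamma> t ^ j)"
        using r by (intro le) simp
      then have "(norm (f (?\<gamma> t)))\<^sup>2 \<le> (norm (\<Sum>j\<le>l. a j * ?\<gamma> t ^ j))\<^sup>2"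
        by (intro power_mono) auto
      moreover have "2 * Re (x * cnj y) - (norm y)\<^sup>2 \<le> (norm x)\<^sup>2" for x y
      proof -
        have "0 \<le> (Re x - Re y)\<^sup>2 + (Im x - Im y)\<^sup>2" by simp
        then show ?thesis by (simp add: cmod_power2 power2_diff algebra_simps)
      qed
      ultimately show "2 * Re (f (?\<gamma> t) * cnj (T (?\<gamma> t))) - (norm (T (?\<gamma> t)))\<^sup>2 \<le> (norm (\<Sum>j\<le>l. a j * ?\<gamma> t ^ j))\<^sup>2"
        by (rule order_trans[rotated])
    qed
    also have "\<dots> \<le> (\<Sum>j\<le>l. 1 * (norm (a j))\<^sup>2)"
      using r by (intro sum_mono mult_right_mono power_le_one) auto
    finally show ?thesis by (simp add: S_def)
  qed
  \<comment> \<open>The upper bound in \<open>ineq\<close> is already free of \<open>r\<close>, so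
    only the left-hand sum has to follow \<open>r\<close> to 1.\<close>
  have "((\<lambda>r. \<Sum>j\<le>m. r ^ (2 * j) * (norm (fps_nth F j))\<^sup>2) \<longlongrightarrow> (\<Sum>j\<le>m. 1 ^ (2 * j) * (norm (fps_nth F j))\<^sup>2)) (at_left 1)"
    by (intro tendsto_intros)
  moreover have "eventually (\<lambda>r. (\<Sum>j\<le>m. r ^ (2 * j) * (norm (fps_nth F j))\<^sup>2) \<le> (\<Sum>j\<le>l. (norm (a j))\<^sup>2)) (at_left (1::real))"
    using eventually_at_left_real[of 0 1] by (rule eventually_mono) (auto intro: ineq)
  ultimately show ?thesis using tendsto_upperbound by fastforce
qed

text \<open>As \<open>W\<close> has no constant term, the coefficients of \<open>F\<close> up to
  \<open>m\<close> involve only those of \<open>G\<close> below \<open>m\<close>. So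
  \<open>G\<close> may be truncated to a polynomial \<open>p\<close>; then
  \<open>|w p| \<le> |p|\<close> on the disc and the comparison of coefficient squares
  applies.\<close>

lemma clunie_coeff_inequality:
  assumes hol: "w holomorphic_on ball 0 1" and le: "\<And>z. z \<in> ball 0 1 \<Longrightarrow> norm (w z) \<le> 1"
    and W: "w has_fps_expansion W" and W0: "fps_nth W 0 = 0" and FG: "F = W * G"
  shows "(\<Sum>j\<le>m. (norm (fps_nth F j))\<^sup>2) \<le> (\<Sum>j<m. (norm (fps_nth G j))\<^sup>2)"
proof (cases m)
  case 0
  then show ?thesis using W0 by (simp add: FG)
next
  case (Suc l)
  let ?p = "\<lambda>z. \<Sum>j\<le>l. fps_nth G j * z ^ j"
  have "Abs_fps (fps_nth G) = G" by (rule fps_ext) simp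
  then have "?p has_fps_expansion fps_cutoff m G"
    using poly_sum_has_fps_expansion[of "fps_nth G" l] Suc by simp
  then have exp: "(\<lambda>z. w z * ?p z) has_fps_expansion W * fps_cutoff m G"
    by (intro has_fps_expansion_mult W)
  have coeff: "fps_nth (W * fps_cutoff m G) j = fps_nth F j" if "j \<le> m" for j
    unfolding FG fps_mult_nth
  proof (intro sum.cong refl)
    fix i assume "i \<in> {0..j}"
    then show "fps_nth W i * fps_nth (fps_cutoff m G) (j - i) = fps_nth W i * fps_nth G (j - i)"
      using that W0 by (cases "i = 0") auto
  qed
  have "(\<Sum>j\<le>m. (norm (fps_nth (W * fps_cutoff m G) j))\<^sup>2) \<le> (\<Sum>j\<le>l. (norm (fps_nth G j))\<^sup>2)"
  proof (rule sum_coeff_squares_le_of_dominated[OF _ exp])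
    show "(\<lambda>z. w z * ?p z) holomorphic_on ball 0 1" by (intro holomorphic_intros hol)
    show "norm (w z * ?p z) \<le> norm (?p z)" if "z \<in> ball 0 1" for z
      using le[OF that] by (simp add: norm_mult mult_left_le_one_le)
  qed
  then show ?thesis using coeff Suc by (simp flip: lessThan_Suc_atMost)
qed

section \<open>The inverse of a holomorphic function on the disc\<close>

text \<open>Rouche on \<open>|z| = s\<close>: \<open>f - w\<close> has as many zeros inside as \<open>f\<close>, namely one.\<close>

lemma unique_preimage_in_disc:
  assumes hol: "f holomorphic_on ball 0 1" and f0: "f 0 = 0" and f': "deriv f 0 \<noteq> 0"
    and nz: "\<And>z. z \<in> ball 0 1 \<Longrightarrow> z \<noteq> 0 \<Longrightarrow> f z \<noteq> 0"
    and s: "0 < s" "s < 1"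
    and big: "\<And>z. s \<le> norm z \<Longrightarrow> norm z < 1 \<Longrightarrow> norm w < norm (f z)"
  shows "\<exists>!z. z \<in> ball 0 1 \<and> f z = w"
proof -
  let ?g = "\<lambda>p. f p + - w"
  define Z where "Z = {p \<in> ball 0 1. ?g p = 0}"
  have hol_g: "?g holomorphic_on ball 0 1" by (intro holomorphic_intros hol)
  have inside: "norm p < s" if "p \<in> Z" for p
    using that big[of p] by (force simp: Z_def)
  have not_const: "\<not> ?g constant_on ball 0 1"
  proof
    assume "?g constant_on ball 0 1"
    then obtain c where c: "\<And>z. z \<in> ball 0 1 \<Longrightarrow> f z + - w = c" by (auto simp: constant_on_def)
    have "f (of_real s) = f 0" using c[of "of_real s"] c[of 0] s by (simp add: algebra_simps)
    then show False using nz[of "of_real s"] s f0 by simp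
  qed
  have "finite {z \<in> cball 0 s. ?g z = 0}"
    using s by (intro holomorphic_compact_finite_zeros[OF hol_g _ _ _ _ not_const]) auto
  then have fin: "finite Z"
    by (rule rev_finite_subset) (use inside in \<open>force simp: Z_def\<close>)
  have zeros_f: "{p \<in> ball 0 1. f p = 0} = {0}" using nz f0 by auto
  \<comment> \<open>The theorem sums over all zeros in the disc. By \<open>inside\<close>, those of
    \<open>f - w\<close> lie within the circle, so each has winding number 1 and the sums count
    zeros with multiplicity.\<close>
  have "(\<Sum>p\<in>Z. winding_number (circlepath 0 s) p * zorder ?g p)
        = (\<Sum>p\<in>{0}. winding_number (circlepath 0 s) p * zorder f p)"
    unfolding Z_def zeros_f[symmetric]
  proof (rule Rouche_theorem)
    show "\<forall>z. z \<notin> ball 0 1 \<longrightarrow> winding_number (circlepath 0 s) z = 0"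
    proof (intro allI impI)
      fix z :: complex assume "z \<notin> ball 0 1"
      then show "winding_number (circlepath 0 s) z = 0"
        using s by (intro winding_number_zero_outside[where s = "cball 0 s"]) auto
    qed
    show "\<forall>z\<in>path_image (circlepath 0 s). norm (- w) < norm (f z)" using big s by auto
    show "finite {p \<in> ball 0 1. ?g p = 0}" using fin by (simp add: Z_def)
    show "finite {p \<in> ball 0 1. f p = 0}" unfolding zeros_f by simp
    show "path_image (circlepath 0 s) \<subseteq> ball 0 1" using s by auto
  qed (use hol in simp_all)
  moreover have "winding_number (circlepath 0 s) p = 1" if "norm p < s" for p
    using that by (intro winding_number_circlepath) simp
  ultimately have "(\<Sum>p\<in>Z. complex_of_int (zorder ?g p)) = zorder f 0"
    using inside s by simp
  also have "zorder f 0 = 1"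
    by (rule zorder_zero_eqI[OF hol]) (auto simp: f0 f')
  finally have sum1: "(\<Sum>p\<in>Z. zorder ?g p) = 1"
    by (metis of_int_1 of_int_eq_iff of_int_sum)
  have pos: "zorder ?g p \<ge> 1" if "p \<in> Z" for p
  proof -
    have "\<exists>z\<in>ball 0 1. ?g z \<noteq> 0"
      using not_const unfolding constant_on_def by meson
    from zorder_exist_zero[OF hol_g _ _ _ this, of p] that show ?thesis
      by (auto simp: Z_def)
  qed
  \<comment> \<open>The orders are at least 1 and add up to 1, which leaves room for exactly one
    zero.\<close>
  have "int (card Z) \<le> (\<Sum>p\<in>Z. zorder ?g p)"
    using sum_mono[of Z "\<lambda>_. 1::int", OF pos] by simp
  then have "card Z \<le> 1" using sum1 by simp
  moreover have "Z \<noteq> {}" using sum1 by auto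
  ultimately have "card Z = 1" using fin by (simp add: le_Suc_eq)
  then have "\<exists>!z. z \<in> Z" by (auto simp: card_1_singleton_iff)
  moreover have "z \<in> Z \<longleftrightarrow> z \<in> ball 0 1 \<and> f z = w" for z by (simp add: Z_def)
  ultimately show ?thesis by simp
qed

text \<open>\<open>the_inv_into\<close> is a definite description over the whole disc, so uniqueness
  of preimages is assumed there. Holomorphy comes from the inverse on the open set \<open>U\<close>
  of points mapped into the small ball, where \<open>f\<close> is injective.\<close>

lemma the_inv_into_holomorphic:
  assumes hol: "f holomorphic_on ball 0 1" 
    and ex1: "\<forall>w\<in>ball 0 R. \<exists>!z. z \<in> ball 0 1 \<and> f z = w"
  shows "the_inv_into (ball 0 1) f holomorphic_on ball 0 R"
    and "\<And>z. z \<in> ball 0 1 \<Longrightarrow> f z \<in> ball 0 R \<Longrightarrow> the_inv_into (ball 0 1) f (f z) = z"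
proof -
  show inv: "the_inv_into (ball 0 1) f (f z) = z" if "z \<in> ball 0 1" "f z \<in> ball 0 R" for z
    unfolding the_inv_into_def by (rule the1_equality[OF bspec[OF ex1 that(2)]]) (use that(1) in simp)
  define U where "U = {z \<in> ball 0 1. f z \<in> ball 0 R}"
  have openU: "open U"
    using continuous_open_preimage[OF holomorphic_on_imp_continuous_on[OF hol] open_ball open_ball, of 0 R]
    by (simp add: U_def vimage_def Int_def)
  have injU: "inj_on f U"
  proof (rule inj_onI)
    fix x y assume "x \<in> U" "y \<in> U" "f x = f y"
    then show "x = y" using inv unfolding U_def by (metis (mono_tags, lifting) mem_Collect_eq)
  qed
  have holU: "f holomorphic_on U" by (rule holomorphic_on_subset[OF hol]) (auto simp: U_def)
  obtain g where g: "g holomorphic_on f ` U" "\<And>z. z \<in> U \<Longrightarrow> deriv f z * deriv g (f z) = 1"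
      "\<And>z. z \<in> U \<Longrightarrow> g (f z) = z"
    by (rule holomorphic_has_inverse[OF holU openU injU]) (rule that; assumption)
  have im: "f ` U = ball 0 R"
  proof
    show "ball 0 R \<subseteq> f ` U"
    proof
      fix w :: complex assume w: "w \<in> ball 0 R"
      then obtain z where "z \<in> ball 0 1" "f z = w" using bspec[OF ex1 w] by blast
      then show "w \<in> f ` U" using w by (auto simp: U_def)
    qed
    show "f ` U \<subseteq> ball 0 R" unfolding U_def by blast
  qed
  have eq: "g w = the_inv_into (ball 0 1) f w" if "w \<in> ball 0 R" for w
  proof -
    have "w \<in> f ` U" using that by (simp only: im)
    then obtain z where "z \<in> U" "f z = w" by (elim imageE) simp
    then show ?thesis using inv[of z] g(3)[of z] by (simp add: U_def)
  qed
  show "the_inv_into (ball 0 1) f holomorphic_on ball 0 R"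
    by (rule holomorphic_transform[OF g(1)[unfolded im] eq])
qed

section \<open>Coefficients of inverses of starlike functions\<close>

lemma eventually_in_unit_ball: "eventually (\<lambda>z::complex. z \<in> ball 0 1) (nhds 0)"
  by (intro eventually_nhds_in_open) auto

lemma fps_expansion_eventually_unique:
  fixes F G :: "complex fps"
  assumes "f has_fps_expansion F" "g has_fps_expansion G" "eventually (\<lambda>z. f z = g z) (nhds 0)"
  shows "F = G"
  using assms(1,2) has_fps_expansion_cong[OF assms(3) refl, of F] by (auto intro: fps_expansion_unique_complex)

text \<open>Carries the equation defining \<open>\<omega>\<close> from \<open>E\<close> over to
  \<open>H = E^(-n)\<close>: it is the hypothesis multiplied by \<open>n E^(-n-1)\<close>, since
  \<open>H' = -n E^(-n-1) E'\<close>. It serves both the general \<open>\<omega>\<close> and the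
  special choice \<open>-z^m\<close>.\<close>

lemma fps_inverse_power_ode:
  fixes E W :: "complex fps" and n :: nat
  assumes E0: "fps_nth E 0 \<noteq> 0"
    and W: "W * (fps_const c * E + fps_X * fps_deriv E) = - (fps_X * fps_deriv E)"
  defines "H \<equiv> inverse E ^ n"
  shows "fps_X * fps_deriv H = W * (fps_const (of_nat n * c) * H - fps_X * fps_deriv H)"
proof -
  define V where "V = inverse E"
  have VE: "V * E = 1" using E0 by (simp add: V_def inverse_mult_eq_1)
  have V': "fps_deriv V = - (V\<^sup>2 * fps_deriv E)"
    using fps_inverse_deriv[OF E0] by (simp add: V_def mult.commute)
  \<comment> \<open>Written with one extra \<open>V\<close>, so that \<open>H\<close> and its
    derivative share the factor \<open>V ^ Suc n\<close>.\<close>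
  have H: "H = V ^ Suc n * E"
    using VE by (simp add: H_def V_def mult.commute mult.left_commute)
  have H': "fps_deriv H = - (fps_const (of_nat n) * V ^ Suc n * fps_deriv E)"
  proof (cases n)
    case (Suc k)
    show ?thesis unfolding H_def V_def[symmetric] Suc fps_deriv_power V'
      by (simp add: power2_eq_square mult_ac)
  qed (simp add: H_def)
  have "fps_const (of_nat n * c) * H - fps_X * fps_deriv H
      = fps_const (of_nat n) * V ^ Suc n * (fps_const c * E + fps_X * fps_deriv E)"
    by (simp only: H' fps_const_mult[symmetric]) (simp add: H algebra_simps)
  then have "W * (fps_const (of_nat n * c) * H - fps_X * fps_deriv H)
      = fps_const (of_nat n) * V ^ Suc n * (W * (fps_const c * E + fps_X * fps_deriv E))"
    by (simp only: mult.left_commute mult.assoc)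
  also have "\<dots> = fps_X * fps_deriv H" unfolding W H' by (simp only: mult_minus_right mult_ac)
  finally show ?thesis by simp
qed

lemma deriv_times_factor:
  assumes e: "e holomorphic_on ball 0 1" and f: "\<And>z. z \<in> ball 0 1 \<Longrightarrow> f z = z * e z" and z: "z \<in> ball 0 1"
  shows "deriv f z = e z + z * deriv e z"
proof -
  have "((\<lambda>z. z * e z) has_field_derivative (e z + z * deriv e z)) (at z)"
    using holomorphic_derivI[OF e open_ball z] by (auto intro!: derivative_eq_intros)
  then have "(f has_field_derivative (e z + z * deriv e z)) (at z)"
    by (rule has_field_derivative_transform_within_open[OF _ open_ball z]) (simp add: f)
  then show ?thesis by (rule DERIV_imp_deriv)
qed

text \<open>Here \<open>e\<close> is \<open>f(z)/z\<close> with the singularity removed, and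
  \<open>z f'/f = 1 + z e'/e\<close> shifts the half-plane by 1. A zero of \<open>f\<close> off the
  origin would make the quotient 0 by the division convention, against
  \<open>\<alpha> \<ge> 0\<close>.\<close>

lemma starlike_factorization:
  assumes f: "f \<in> starlike_of_order \<alpha>" and \<alpha>: "0 \<le> \<alpha>"
  obtains e where "e holomorphic_on ball 0 1" "e 0 = 1" "\<And>z. z \<in> ball 0 1 \<Longrightarrow> e z \<noteq> 0"
    "\<And>z. z \<in> ball 0 1 \<Longrightarrow> f z = z * e z"
    "\<And>z. z \<in> ball 0 1 \<Longrightarrow> Re (z * deriv e z / e z) > \<alpha> - 1"
proof -
  have hol: "f holomorphic_on ball 0 1" and f0: "f 0 = 0" and f': "deriv f 0 = 1"
    and Re: "\<And>z. z \<in> ball 0 1 \<Longrightarrow> Re (if z = 0 then 1 else z * deriv f z / f z) > \<alpha>"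
    using f by (auto simp: starlike_of_order_def)
  define e where "e = (\<lambda>z. if z = 0 then deriv f 0 else (f z - f 0) / (z - 0))"
  have e: "e holomorphic_on ball 0 1"
    unfolding e_def by (rule pole_lemma_open[OF hol open_ball])
  have e0: "e 0 = 1" by (simp add: e_def f')
  have fe: "f z = z * e z" for z by (simp add: e_def f0)
  have nz: "e z \<noteq> 0" if "z \<in> ball 0 1" for z
  proof
    assume "e z = 0"
    with e0 have "z \<noteq> 0" "f z = 0" by (auto simp: fe)
    with Re[OF that] \<alpha> show False by simp
  qed
  have "Re (z * deriv e z / e z) > \<alpha> - 1" if z: "z \<in> ball 0 1" for z
  proof (cases "z = 0")
    case True
    \<comment> \<open>At the origin the claim reads \<open>\<alpha> < 1\<close>, which follows from
      the value 1 prescribed there.\<close>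
    then show ?thesis using Re[of 0] by simp
  next
    case False
    have "z * deriv f z / f z = 1 + z * deriv e z / e z"
      using False nz[OF z] by (simp add: deriv_times_factor[OF e fe z] fe[of z] field_simps)
    then show ?thesis using Re[OF z] False by simp
  qed
  then show ?thesis using that e e0 nz fe by blast
qed

text \<open>Put \<open>q = z e'/e\<close> and \<open>c = 2(1 - \<alpha>)\<close>. Then
  \<open>Re q > -c/2\<close> says that \<open>q\<close> is nearer to 0 than to \<open>-c\<close>, so
  \<open>w = -q/(c + q)\<close> is bounded by 1 and vanishes at 0. This \<open>w\<close> is the
  function \<open>\<omega>\<close> to which Clunie's inequality is applied.\<close>

lemma starlike_coeff_inequality:
  fixes \<alpha> :: real and n :: nat
  assumes e: "e holomorphic_on ball 0 1" and e0: "e 0 = 1" and nz: "\<And>z. z \<in> ball 0 1 \<Longrightarrow> e z \<noteq> 0"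
    and Re: "\<And>z. z \<in> ball 0 1 \<Longrightarrow> Re (z * deriv e z / e z) > \<alpha> - 1"
    and \<alpha>: "\<alpha> < 1" and E: "e has_fps_expansion E"
  defines "h \<equiv> \<lambda>j. norm (fps_nth (inverse E ^ n) j)" and "\<beta> \<equiv> 2 * real n * (1 - \<alpha>)"
  shows "(real m * h m)\<^sup>2 \<le> (\<Sum>j<m. \<beta> * (\<beta> - 2 * real j) * (h j)\<^sup>2)"
proof -
  define c where "c = complex_of_real (2 * (1 - \<alpha>))"
  define D where "D = (\<lambda>z. c * e z + z * deriv e z)"
  define w where "w = (\<lambda>z. - (z * deriv e z) / D z)"
  have E0: "fps_nth E 0 = 1" using has_fps_expansion_imp_0_eq_fps_nth_0[OF E] e0 by simp
  have factor: "D z = e z * (c + z * deriv e z / e z)" if "z \<in> ball 0 1" for z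
    using nz[OF that] by (simp add: D_def field_simps)
  have D_nz: "D z \<noteq> 0" if "z \<in> ball 0 1" for z
  proof -
    have "Re (c + z * deriv e z / e z) > 0" using Re[OF that] \<alpha> by (simp add: c_def)
    then have "c + z * deriv e z / e z \<noteq> 0" by (metis less_irrefl zero_complex.sel(1))
    then show ?thesis using factor[OF that] nz[OF that] by simp
  qed
  have w_hol: "w holomorphic_on ball 0 1"
    unfolding w_def using D_nz unfolding D_def by (intro holomorphic_intros e holomorphic_deriv) auto
  have w_le: "norm (w z) \<le> 1" if z: "z \<in> ball 0 1" for z
  proof -
    define q where "q = z * deriv e z / e z"
    have q: "Re q > \<alpha> - 1" using Re[OF z] by (simp add: q_def)
    have "z * deriv e z = e z * q" using nz[OF z] by (simp add: q_def)
    then have "w z = - q / (c + q)"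
      using nz[OF z] unfolding w_def factor[OF z] q_def[symmetric] by simp
    moreover have "norm q \<le> norm (c + q)"
    proof (rule power2_le_imp_le)
      have "(norm (c + q))\<^sup>2 - (norm q)\<^sup>2 = 4 * (1 - \<alpha>) * (1 - \<alpha> + Re q)"
        by (simp add: cmod_power2 c_def) (simp add: power2_eq_square algebra_simps)
      moreover have "4 * (1 - \<alpha>) * (1 - \<alpha> + Re q) \<ge> 0" using q \<alpha> by (intro mult_nonneg_nonneg) auto
      ultimately show "(norm q)\<^sup>2 \<le> (norm (c + q))\<^sup>2" by linarith
    qed simp
    ultimately show ?thesis by (simp add: norm_divide divide_le_eq_1)
  qed
  define W where "W = fps_expansion w 0"
  have W: "w has_fps_expansion W"
    unfolding W_def by (rule has_fps_expansion_fps_expansion[OF open_ball _ w_hol]) simp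
  have W0: "fps_nth W 0 = 0"
    using has_fps_expansion_imp_0_eq_fps_nth_0[OF W] by (simp add: w_def)
  have "(\<lambda>z. w z * (c * e z + z * deriv e z)) has_fps_expansion W * (fps_const c * E + fps_X * fps_deriv E)"
    by (intro fps_expansion_intros W E)
  moreover have "(\<lambda>z. - (z * deriv e z)) has_fps_expansion - (fps_X * fps_deriv E)"
    by (intro fps_expansion_intros E)
  moreover have "eventually (\<lambda>z. w z * (c * e z + z * deriv e z) = - (z * deriv e z)) (nhds 0)"
    using eventually_in_unit_ball
    by (rule eventually_mono) (use D_nz in \<open>auto simp: w_def D_def\<close>)
  ultimately have "W * (fps_const c * E + fps_X * fps_deriv E) = - (fps_X * fps_deriv E)"
    by (rule fps_expansion_eventually_unique)
  define H where "H = inverse E ^ n"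
  have \<beta>: "of_nat n * c = complex_of_real \<beta>" by (simp add: c_def \<beta>_def mult_ac)
  have "fps_X * fps_deriv H = W * (fps_const (of_real \<beta>) * H - fps_X * fps_deriv H)"
    using fps_inverse_power_ode[OF _ \<open>W * _ = _\<close>, of n] E0 unfolding H_def \<beta> by simp
  note clunie = clunie_coeff_inequality[OF w_hol w_le W W0 this]
  have XH: "fps_nth (fps_X * fps_deriv H) j = of_nat j * fps_nth H j" for j
    by (cases j) simp_all
  have n1: "(norm (fps_nth (fps_X * fps_deriv H) j))\<^sup>2 = (real j * h j)\<^sup>2" for j
    unfolding XH by (simp add: norm_mult h_def H_def)
  have n2: "(norm (fps_nth (fps_const (of_real \<beta>) * H - fps_X * fps_deriv H) j))\<^sup>2 = (\<beta> - real j)\<^sup>2 * (h j)\<^sup>2" for j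
  proof -
    have "fps_nth (fps_const (of_real \<beta>) * H - fps_X * fps_deriv H) j = of_real (\<beta> - real j) * fps_nth H j"
      unfolding fps_sub_nth XH by (simp add: algebra_simps)
    then show ?thesis by (simp only: norm_mult norm_of_real power_mult_distrib power2_abs h_def H_def)
  qed
  \<comment> \<open>The two sides compare coefficients \<open>j h_j\<close> and
    \<open>(\<beta> - j) h_j\<close>. Moving the terms \<open>j < m\<close> to the right produces
    the weights \<open>(\<beta> - j)^2 - j^2 = \<beta>(\<beta> - 2j)\<close>.\<close>
  have "(\<Sum>j\<le>m. (real j * h j)\<^sup>2) \<le> (\<Sum>j<m. (\<beta> - real j)\<^sup>2 * (h j)\<^sup>2)"
    using clunie[of m] by (simp only: n1 n2)
  moreover have "(\<Sum>j\<le>m. (real j * h j)\<^sup>2) = (\<Sum>j<m. (real j * h j)\<^sup>2) + (real m * h m)\<^sup>2"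
    by (simp flip: lessThan_Suc_atMost)
  ultimately have "(real m * h m)\<^sup>2 \<le> (\<Sum>j<m. (\<beta> - real j)\<^sup>2 * (h j)\<^sup>2 - (real j * h j)\<^sup>2)"
    by (simp add: sum_subtractf)
  also have "\<dots> = (\<Sum>j<m. \<beta> * (\<beta> - 2 * real j) * (h j)\<^sup>2)"
    by (intro sum.cong) (auto simp: power2_eq_square algebra_simps)
  finally show ?thesis .
qed

section \<open>Growth of starlike functions along radii\<close>

text \<open>With \<open>z = t u\<close>, the derivative of \<open>|f(t u)|^2\<close> in
  \<open>t\<close> is \<open>(2/t) |f(z)|^2 Re (z f'(z)/f(z))\<close>, which starlikeness makes
  nonnegative.\<close>

lemma starlike_norm_radial_mono:
  assumes f: "f \<in> starlike_of_order \<alpha>" and \<alpha>: "0 \<le> \<alpha>" and u: "norm u = 1" and rs: "0 < r" "r \<le> s" "s < 1"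
  shows "norm (f (of_real r * u)) \<le> norm (f (of_real s * u))"
proof -
  have hol: "f holomorphic_on ball 0 1" 
    and Re: "\<And>z. z \<in> ball 0 1 \<Longrightarrow> Re (if z = 0 then 1 else z * deriv f z / f z) > \<alpha>"
    using f by (auto simp: starlike_of_order_def)
  define p where "p = (\<lambda>t. f (of_real t * u))"
  have "(Re (p r))\<^sup>2 + (Im (p r))\<^sup>2 \<le> (Re (p s))\<^sup>2 + (Im (p s))\<^sup>2"
  proof (rule DERIV_nonneg_imp_nondecreasing[OF rs(2)])
    fix t assume t: "r \<le> t" "t \<le> s"
    define z where "z = of_real t * u"
    have z: "z \<in> ball 0 1" "z \<noteq> 0" using t rs u by (auto simp: z_def norm_mult)
    have "(f has_field_derivative deriv f z) (at z)" by (rule holomorphic_derivI[OF hol open_ball z(1)])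
    moreover have "((\<lambda>t. of_real t * u) has_vector_derivative u) (at t)"
      by (auto intro!: derivative_eq_intros simp: has_vector_derivative_def scaleR_conv_of_real)
    ultimately have p': "(p has_vector_derivative (u * deriv f z)) (at t)"
      using field_vector_diff_chain_at[of "\<lambda>t. of_real t * u" u t f] by (simp add: z_def p_def o_def)
    have dRe: "((\<lambda>t. Re (p t)) has_real_derivative Re (u * deriv f z)) (at t)"
      using bounded_linear.has_vector_derivative[OF bounded_linear_Re p']
      by (simp only: has_real_derivative_iff_has_vector_derivative)
    have dIm: "((\<lambda>t. Im (p t)) has_real_derivative Im (u * deriv f z)) (at t)"
      using bounded_linear.has_vector_derivative[OF bounded_linear_Im p']
      by (simp only: has_real_derivative_iff_has_vector_derivative)
    have d: "((\<lambda>t. (Re (p t))\<^sup>2 + (Im (p t))\<^sup>2) has_real_derivative 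
        2 * (Re (p t) * Re (u * deriv f z) + Im (p t) * Im (u * deriv f z))) (at t)"
      by (rule DERIV_cong[OF DERIV_add[OF DERIV_power[OF dRe] DERIV_power[OF dIm]]]) (simp add: algebra_simps)
    have nonneg: "Re (p t) * Re (u * deriv f z) + Im (p t) * Im (u * deriv f z) \<ge> 0"
    proof -
      have pz: "p t = f z" by (simp add: p_def z_def)
      have q: "Re (z * deriv f z / f z) > 0" using Re[OF z(1)] z(2) \<alpha> by simp
      then have fz: "f z \<noteq> 0" by auto
      \<comment> \<open>The factor \<open>t > 0\<close> turns \<open>u\<close> into
        \<open>z\<close>, so that the starlike quotient appears.\<close>
      have "t * (Re (p t) * Re (u * deriv f z) + Im (p t) * Im (u * deriv f z)) = Re (cnj (f z) * (z * deriv f z))"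
        by (simp add: pz) (simp add: z_def algebra_simps)
      also have "cnj (f z) * (z * deriv f z) = (cnj (f z) * f z) * (z * deriv f z / f z)"
        using fz by simp
      also have "\<dots> = of_real ((norm (f z))\<^sup>2) * (z * deriv f z / f z)"
        by (simp only: complex_norm_square mult.commute)
      also have "Re \<dots> = (norm (f z))\<^sup>2 * Re (z * deriv f z / f z)"
        by (simp only: times_complex.sel Re_complex_of_real Im_complex_of_real mult_zero_left diff_zero)
      also have "\<dots> \<ge> 0" using q by (intro mult_nonneg_nonneg) auto
      finally show ?thesis using t rs by (simp add: zero_le_mult_iff)
    qed
    show "\<exists>y. ((\<lambda>t. (Re (p t))\<^sup>2 + (Im (p t))\<^sup>2) has_real_derivative y) (at t) \<and> 0 \<le> y"
      by (rule exI, rule conjI, rule d) (rule mult_nonneg_nonneg[OF zero_le_numeral nonneg])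
  qed
  then have "(norm (p r))\<^sup>2 \<le> (norm (p s))\<^sup>2" by (simp only: cmod_power2)
  then have "norm (p r) \<le> norm (p s)" by (rule power2_le_imp_le) simp
  then show ?thesis by (simp only: p_def)
qed

text \<open>The minimum on the circle of radius 1/2 propagates outwards by radial monotonicity.
  Rouche needs such a bound near the boundary; any positive \<open>\<delta>\<close> will do, as
  coefficients of the inverse depend only on its germ at 0.\<close>

lemma starlike_norm_lower_bound:
  assumes f: "f \<in> starlike_of_order \<alpha>" and \<alpha>: "0 \<le> \<alpha>"
  obtains \<delta> where "\<delta> > 0" "\<And>z. 1/2 \<le> norm z \<Longrightarrow> norm z < 1 \<Longrightarrow> \<delta> \<le> norm (f z)"
proof -
  have hol: "f holomorphic_on ball 0 1" 
    and Re: "\<And>z. z \<in> ball 0 1 \<Longrightarrow> Re (if z = 0 then 1 else z * deriv f z / f z) > \<alpha>"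
    using f by (auto simp: starlike_of_order_def)
  have "continuous_on (sphere 0 (1/2)) (\<lambda>z. norm (f z))"
    by (intro continuous_intros holomorphic_on_imp_continuous_on holomorphic_on_subset[OF hol]) auto
  moreover have "compact (sphere (0::complex) (1/2))" "sphere (0::complex) (1/2) \<noteq> {}" by auto
  ultimately obtain z0 where z0: "z0 \<in> sphere 0 (1/2)" "\<And>z. z \<in> sphere 0 (1/2) \<Longrightarrow> norm (f z0) \<le> norm (f z)"
    using continuous_attains_inf[of "sphere 0 (1/2)" "\<lambda>z. norm (f z)"] by blast
  show ?thesis
  proof (rule that)
    have "z0 \<in> ball 0 1" "z0 \<noteq> 0" using z0(1) by auto
    then show "norm (f z0) > 0" using Re[of z0] \<alpha> by auto
    fix z :: complex assume z: "1/2 \<le> norm z" "norm z < 1"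
    define u where "u = z / of_real (norm z)"
    have "z \<noteq> 0" using z by auto
    then have u: "norm u = 1" "z = of_real (norm z) * u"
      by (auto simp: u_def norm_divide)
    have "norm (f z0) \<le> norm (f (of_real (1/2) * u))"
      using u by (intro z0(2)) (simp add: norm_mult)
    also have "\<dots> \<le> norm (f (of_real (norm z) * u))"
      using z by (intro starlike_norm_radial_mono[OF f \<alpha> u(1)]) auto
    finally show "norm (f z0) \<le> norm (f z)" using u(2) by simp
  qed
qed

section \<open>Coefficients of the inverse function and their bounds\<close>

lemma inverse_series_coeff:
  fixes e f g :: "complex \<Rightarrow> complex"
  assumes e: "e has_fps_expansion E" and E0: "fps_nth E 0 \<noteq> 0" 
    and f: "eventually (\<lambda>z. f z = z * e z) (nhds 0)"
    and g: "g has_fps_expansion B" and gf: "eventually (\<lambda>z. g (f z) = z) (nhds 0)" and n: "n \<ge> 1"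
  shows "of_nat n * fps_nth B n = fps_nth (inverse E ^ n) (n - 1)"
proof (rule fps_lagrange_inversion[OF E0 _ n])
  have "(\<lambda>z. z * e z) has_fps_expansion fps_X * E" by (intro fps_expansion_intros e)
  then have "f has_fps_expansion fps_X * E"
    using has_fps_expansion_cong[OF f refl] by simp
  then have "(g \<circ> f) has_fps_expansion (B oo (fps_X * E))"
    by (intro has_fps_expansion_compose g) auto
  then show "B oo (fps_X * E) = fps_X"
    by (rule fps_expansion_eventually_unique[OF _ has_fps_expansion_fps_X]) (use gf in simp)
qed

text \<open>\<open>inverse_expansion\<close> speaks of a definite description, which is an actual
  inverse only where preimages in the disc are unique. Rouche secures this on a ball of radius
  \<open>R\<close>, and Lagrange inversion then applies to the germs.\<close>

lemma starlike_inverse_coeff: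
  assumes f: "f \<in> starlike_of_order \<alpha>" and \<alpha>: "0 \<le> \<alpha>" and A: "inverse_expansion f A"
    and fe: "\<And>z. z \<in> ball 0 1 \<Longrightarrow> f z = z * e z" and e: "e holomorphic_on ball 0 1" and e0: "e 0 = 1"
    and E: "e has_fps_expansion E" and n: "n \<ge> 2"
  shows "of_nat n * A n = fps_nth (inverse E ^ n) (n - 1)"
proof -
  have hol: "f holomorphic_on ball 0 1" and f0: "f 0 = 0" and f': "deriv f 0 = 1"
    and Re: "\<And>z. z \<in> ball 0 1 \<Longrightarrow> Re (if z = 0 then 1 else z * deriv f z / f z) > \<alpha>"
    using f by (auto simp: starlike_of_order_def)
  have nz: "f z \<noteq> 0" if "z \<in> ball 0 1" "z \<noteq> 0" for z
    using Re[OF that(1)] that(2) \<alpha> by auto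
  obtain \<delta> where \<delta>: "\<delta> > 0" "\<And>z. 1/2 \<le> norm z \<Longrightarrow> norm z < 1 \<Longrightarrow> \<delta> \<le> norm (f z)"
    using starlike_norm_lower_bound[OF f \<alpha>] by blast
  define R where "R = min \<delta> (1/4)"
  have R: "R > 0" "R \<le> 1/4" "R \<le> \<delta>" using \<delta>(1) by (auto simp: R_def)
  define g where "g = the_inv_into (ball 0 1) f"
  have "\<exists>!z. z \<in> ball 0 1 \<and> f z = w" if "w \<in> ball 0 R" for w
  proof (rule unique_preimage_in_disc[OF hol f0 _ nz, of "1/2"])
    fix z :: complex assume "1/2 \<le> norm z" "norm z < 1"
    then show "norm w < norm (f z)" using \<delta>(2)[of z] that R by simp
  qed (use f' in auto)
  then have "\<forall>w\<in>ball 0 R. \<exists>!z. z \<in> ball 0 1 \<and> f z = w" by blast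
  note inv = the_inv_into_holomorphic(2)[OF hol this, folded g_def]
  have ev_f: "eventually (\<lambda>z. f z = z * e z) (nhds 0)"
    using eventually_in_unit_ball by (rule eventually_mono) (use fe in auto)
  have "isCont f 0" using hol by (metis centre_in_ball continuous_on_interior holomorphic_on_imp_continuous_on interior_ball zero_less_one)
  then have "(f \<longlongrightarrow> f 0) (nhds 0)" by (simp only: isCont_def tendsto_at_iff_tendsto_nhds)
  then have "eventually (\<lambda>z. f z \<in> ball 0 R) (nhds 0)"
    by (rule topological_tendstoD) (use R f0 in auto)
  then have gf: "eventually (\<lambda>z. g (f z) = z) (nhds 0)"
    using eventually_in_unit_ball by eventually_elim (use inv in auto)
  \<comment> \<open>\<open>inverse_expansion\<close> fixes \<open>A\<close> only from index 2 on;
    the values 0 and 1 supply the missing terms of the series of \<open>g\<close>.\<close>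
  define B where "B = Abs_fps (\<lambda>k. if k = 0 then 0 else if k = 1 then 1 else A k)"
  have "(\<lambda>k. fps_nth B k * w ^ k) sums g w" if w: "w \<in> ball 0 (1/4)" for w
  proof -
    have "(\<lambda>k. fps_nth B (k + 2) * w ^ (k + 2)) sums (g w - w)"
      using A w by (simp add: inverse_expansion_def g_def B_def)
    then show ?thesis by (subst (asm) sums_iff_shift) (simp add: B_def numeral_2_eq_2)
  qed
  then have "g has_fps_expansion B"
    by (intro has_fps_expansionI eventually_mono[OF eventually_nhds_in_open[of "ball 0 (1/4)"]]) auto
  from inverse_series_coeff[OF E _ ev_f this gf, of n] 
  have "of_nat n * fps_nth B n = fps_nth (inverse E ^ n) (n - 1)"
    using has_fps_expansion_imp_0_eq_fps_nth_0[OF E] e0 n by simp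
  then show ?thesis using n by (simp add: B_def)
qed

text \<open>One bound for all three ranges, with \<open>N = n - 1\<close>, \<open>n - k\<close> and
  \<open>1\<close> respectively. The hypotheses say that the weight at \<open>N - 1\<close> is
  positive and, if an index below \<open>n - 1\<close> is left over, that the weight at
  \<open>N\<close> is not. The factor \<open>n - 1\<close> comes from bounding
  \<open>m |h_m|\<close> at \<open>m = n - 1\<close>.\<close>

lemma starlike_inverse_coeff_bound:
  assumes f: "f \<in> starlike_of_order \<alpha>" and \<alpha>: "0 \<le> \<alpha>" "\<alpha> < 1" and A: "inverse_expansion f A" and n: "n \<ge> 2"
    and N: "1 \<le> N" "N \<le> n - 1" "2 * real n * (1 - \<alpha>) > 2 * (real N - 1)"
      "N < n - 1 \<Longrightarrow> real n * (1 - \<alpha>) \<le> real N"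
  shows "norm (A n) \<le> Gamma (2 * real n * (1 - \<alpha>) + 1) / 
     (real n * (real n - 1) * Gamma (real N) * Gamma (2 * real n * (1 - \<alpha>) - real N + 1))"
proof -
  define \<beta> where "\<beta> = 2 * real n * (1 - \<alpha>)"
  obtain e where e: "e holomorphic_on ball 0 1" "e 0 = 1" "\<And>z. z \<in> ball 0 1 \<Longrightarrow> e z \<noteq> 0"
    "\<And>z. z \<in> ball 0 1 \<Longrightarrow> f z = z * e z"
    "\<And>z. z \<in> ball 0 1 \<Longrightarrow> Re (z * deriv e z / e z) > \<alpha> - 1"
    using starlike_factorization[OF f \<alpha>(1)] by blast
  define E where "E = fps_expansion e 0"
  have E: "e has_fps_expansion E"
    unfolding E_def by (rule has_fps_expansion_fps_expansion[OF open_ball _ e(1)]) simp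
  have E0: "fps_nth E 0 = 1" using has_fps_expansion_imp_0_eq_fps_nth_0[OF E] e by simp
  have "real n * norm (A n) = norm (fps_nth (inverse E ^ n) (n - 1))"
    using starlike_inverse_coeff[OF f \<alpha>(1) A e(4,1,2) E n] by (metis norm_mult norm_of_nat)
  then have "(real n - 1) * (real n * norm (A n)) = real (n - 1) * norm (fps_nth (inverse E ^ n) (n - 1))"
    using n by (simp add: of_nat_diff)
  also have "\<dots> \<le> real N * (\<beta> gchoose N)"
  proof (rule clunie_recursion_bound)
    show "norm (fps_nth (inverse E ^ n) 0) = 1" using E0 by (simp add: fps_nth_power_0)
    show "(real m * norm (fps_nth (inverse E ^ n) m))\<^sup>2
         \<le> (\<Sum>j<m. \<beta> * (\<beta> - 2 * real j) * (norm (fps_nth (inverse E ^ n) j))\<^sup>2)" for m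
      unfolding \<beta>_def by (rule starlike_coeff_inequality[OF e(1,2,3,5) \<alpha>(2) E])
    show "\<beta> \<le> 2 * real j" if "N \<le> j" "j < n - 1" for j
    proof -
      have "real n * (1 - \<alpha>) \<le> real N" using that by (intro N(4)) simp
      also have "\<dots> \<le> real j" using that by simp
      finally show ?thesis by (simp add: \<beta>_def mult.assoc)
    qed
  qed (use N in \<open>auto simp: \<beta>_def\<close>)
  also have "\<dots> = Gamma (\<beta> + 1) / (Gamma (real N) * Gamma (\<beta> - real N + 1))"
    using N by (intro gbinomial_Gamma_top) (auto simp: \<beta>_def)
  finally have "norm (A n) \<le> Gamma (\<beta> + 1) / (Gamma (real N) * Gamma (\<beta> - real N + 1)) / (real n * (real n - 1))"
    using n by (subst pos_le_divide_eq) (simp_all add: mult_ac)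
  then show ?thesis by (simp add: \<beta>_def mult_ac)
qed

section \<open>The extremal functions\<close>

text \<open>The principal branch of \<open>(1 - z^m)^(-2(1-\<alpha>)/m)\<close>. On the disc
  \<open>1 - z^m\<close> stays in the right half-plane, away from the cut, and the form through
  \<open>exp\<close> makes nonvanishing immediate.\<close>

definition extremal_factor :: "real \<Rightarrow> nat \<Rightarrow> complex \<Rightarrow> complex" where
  "extremal_factor \<alpha> m z = exp (- of_real (2 * (1 - \<alpha>) / real m) * Ln (1 - z ^ m))"

lemma one_minus_power_in_slit_plane:
  fixes z :: complex
  assumes "z \<in> ball 0 1" "m \<ge> 1"
  shows "1 - z ^ m \<notin> \<real>\<^sub>\<le>\<^sub>0" "1 - z ^ m \<noteq> 0" "norm (z ^ m) < 1"
proof -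
  show n: "norm (z ^ m) < 1" using assms by (simp add: norm_power power_less_one_iff)
  have "Re (z ^ m) < 1" using complex_Re_le_cmod[of "z ^ m"] n by linarith
  then have "Re (1 - z ^ m) > 0" by simp
  then show "1 - z ^ m \<notin> \<real>\<^sub>\<le>\<^sub>0" by (auto simp: complex_nonpos_Reals_iff)
  then show "1 - z ^ m \<noteq> 0" by auto
qed

lemma extremal_factor_holomorphic: "m \<ge> 1 \<Longrightarrow> extremal_factor \<alpha> m holomorphic_on ball 0 1"
  unfolding extremal_factor_def using one_minus_power_in_slit_plane(1)
  by (intro holomorphic_intros) auto

lemma extremal_factor_nonzero [simp]: "extremal_factor \<alpha> m z \<noteq> 0"
  by (simp add: extremal_factor_def)

lemma extremal_factor_0: "m \<ge> 1 \<Longrightarrow> extremal_factor \<alpha> m 0 = 1"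
  by (simp add: extremal_factor_def power_0_left)

lemma deriv_extremal_factor:
  assumes m: "m \<ge> 1" and z: "z \<in> ball 0 1"
  shows "z * deriv (extremal_factor \<alpha> m) z
         = of_real (2 * (1 - \<alpha>)) * z ^ m / (1 - z ^ m) * extremal_factor \<alpha> m z"
proof -
  note u = one_minus_power_in_slit_plane[OF z m]
  define \<gamma> where "\<gamma> = complex_of_real (2 * (1 - \<alpha>) / real m)"
  have "(extremal_factor \<alpha> m has_field_derivative
          (exp (- \<gamma> * Ln (1 - z ^ m)) * (- \<gamma> * (- (of_nat m * z ^ (m - 1)) / (1 - z ^ m))))) (at z)"
    unfolding extremal_factor_def[abs_def] \<gamma>_def[symmetric] using u
    by (auto intro!: derivative_eq_intros simp: divide_inverse mult_ac)
  then have "deriv (extremal_factor \<alpha> m) z = extremal_factor \<alpha> m z * (- \<gamma> * (- (of_nat m * z ^ (m - 1)) / (1 - z ^ m)))"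
    by (simp only: DERIV_imp_deriv extremal_factor_def \<gamma>_def)
  moreover have "z * z ^ (m - 1) = z ^ m" using m by (cases m) auto
  moreover have "\<gamma> * of_nat m = of_real (2 * (1 - \<alpha>))" using m by (simp add: \<gamma>_def)
  ultimately show ?thesis by (simp add: divide_inverse) (metis mult.assoc mult.commute)
qed

text \<open>With \<open>v = 1/(1 - u)\<close> the quotient is \<open>v - 1\<close>, and
  \<open>|v - 1| = |u| |v| < |v|\<close> places \<open>v\<close> nearer to 1 than to 0.\<close>

lemma Re_div_one_minus_gt:
  fixes u :: complex
  assumes "norm u < 1"
  shows "Re (u / (1 - u)) > - (1/2)"
proof -
  have nz: "1 - u \<noteq> 0" using assms by auto
  define v where "v = inverse (1 - u)"
  have v: "v \<noteq> 0" "u = 1 - inverse v" using nz by (auto simp: v_def)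
  have eq: "u / (1 - u) = v - 1" using nz by (simp add: v_def field_simps)
  have "norm (v - 1) < norm v"
  proof -
    have "v - 1 = u * v" using v by (simp add: field_simps)
    then show ?thesis using assms v by (simp add: norm_mult)
  qed
  then have "(norm (v - 1))\<^sup>2 < (norm v)\<^sup>2" by (intro power_strict_mono) auto
  then show ?thesis unfolding eq by (simp add: cmod_power2 power2_diff)
qed

lemma extremal_factor_Re:
  assumes m: "m \<ge> 1" and z: "z \<in> ball 0 1" and \<alpha>: "\<alpha> < 1"
  shows "Re (z * deriv (extremal_factor \<alpha> m) z / extremal_factor \<alpha> m z) > \<alpha> - 1"
proof -
  have "z * deriv (extremal_factor \<alpha> m) z / extremal_factor \<alpha> m z = of_real (2 * (1 - \<alpha>)) * (z ^ m / (1 - z ^ m))"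
    by (simp add: deriv_extremal_factor[OF m z])
  then have "Re (z * deriv (extremal_factor \<alpha> m) z / extremal_factor \<alpha> m z) = 2 * (1 - \<alpha>) * Re (z ^ m / (1 - z ^ m))"
    by (simp only: times_complex.sel Re_complex_of_real Im_complex_of_real mult_zero_left diff_zero)
  moreover have "2 * (1 - \<alpha>) * Re (z ^ m / (1 - z ^ m)) > 2 * (1 - \<alpha>) * (- (1/2))"
    using Re_div_one_minus_gt[OF one_minus_power_in_slit_plane(3)[OF z m]] \<alpha> by (intro mult_strict_left_mono) auto
  moreover have "2 * (1 - \<alpha>) * (- (1/2)) = \<alpha> - 1" by (simp add: field_simps)
  ultimately show ?thesis by linarith
qed

lemma extremal_starlike:
  assumes m: "m \<ge> 1" and \<alpha>: "\<alpha> < 1"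
  shows "(\<lambda>z. z * extremal_factor \<alpha> m z) \<in> starlike_of_order \<alpha>"
proof -
  let ?f = "\<lambda>z. z * extremal_factor \<alpha> m z"
  have d: "deriv ?f z = extremal_factor \<alpha> m z + z * deriv (extremal_factor \<alpha> m) z" if "z \<in> ball 0 1" for z
    using that by (intro deriv_times_factor[OF extremal_factor_holomorphic[OF m]]) auto
  have "Re (z * deriv ?f z / ?f z) > \<alpha>" if "z \<in> ball 0 1" "z \<noteq> 0" for z
  proof -
    have "z * deriv ?f z / ?f z = 1 + z * deriv (extremal_factor \<alpha> m) z / extremal_factor \<alpha> m z"
      using that(2) by (simp add: d[OF that(1)] field_simps)
    then show ?thesis using extremal_factor_Re[OF m that(1) \<alpha>] by simp
  qed
  moreover have "?f holomorphic_on ball 0 1"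
    by (intro holomorphic_intros extremal_factor_holomorphic m)
  ultimately show ?thesis
    using \<alpha> m by (auto simp: starlike_of_order_def d extremal_factor_0)
qed

section \<open>Inverse expansions of the extremal functions\<close>

text \<open>The growth bound of the Koebe function: \<open>|1 - z^m| \<le> 1 + |z|\<close> and the
  exponent lies between 0 and 2. Its limit 1/4 at the boundary gives the inverse on the full ball
  required by \<open>inverse_expansion\<close>.\<close>

lemma extremal_norm_ge:
  assumes m: "m \<ge> 1" and \<alpha>: "0 \<le> \<alpha>" "\<alpha> < 1" and z: "z \<in> ball 0 1"
  shows "norm (z * extremal_factor \<alpha> m z) \<ge> norm z / (1 + norm z)\<^sup>2"
proof -
  note u = one_minus_power_in_slit_plane[OF z m]
  define \<gamma> where "\<gamma> = 2 * (1 - \<alpha>) / real m"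
  have \<gamma>: "0 \<le> \<gamma>" "\<gamma> \<le> 2" using m \<alpha> by (auto simp: \<gamma>_def divide_le_eq)
  have "norm (1 - z ^ m) \<le> 1 + norm z ^ m" 
    using norm_triangle_ineq4[of 1 "z ^ m"] by (simp add: norm_power)
  also have "norm z ^ m \<le> norm z ^ 1" using z m by (intro power_decreasing) auto
  finally have "ln (norm (1 - z ^ m)) \<le> ln (1 + norm z)"
    using u(2) by (subst ln_le_cancel_iff) (auto intro: add_pos_nonneg)
  then have "\<gamma> * ln (norm (1 - z ^ m)) \<le> \<gamma> * ln (1 + norm z)" using \<gamma> by (intro mult_left_mono)
  \<comment> \<open>Raising the exponent to 2 is safe only now: \<open>ln (1 + norm z)\<close> is
    nonnegative, while \<open>ln (norm (1 - z ^ m))\<close> can be negative.\<close>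
  also have "\<dots> \<le> 2 * ln (1 + norm z)" using \<gamma> by (intro mult_right_mono) auto
  finally have "exp (- (2 * ln (1 + norm z))) \<le> exp (- (\<gamma> * ln (norm (1 - z ^ m))))" by simp
  also have "\<dots> = norm (extremal_factor \<alpha> m z)"
    unfolding extremal_factor_def \<gamma>_def[symmetric] using u(2) by (simp add: norm_exp_eq_Re)
  also have "exp (- (2 * ln (1 + norm z))) = 1 / (1 + norm z)\<^sup>2"
  proof -
    have "2 * ln (1 + norm z) = ln ((1 + norm z)\<^sup>2)" 
      by (subst ln_realpow) (auto intro: add_pos_nonneg)
    moreover have "(1 + norm z)\<^sup>2 > 0" by (intro zero_less_power add_pos_nonneg) auto
    ultimately show ?thesis by (simp add: exp_minus inverse_eq_divide)
  qed
  finally have "norm z * (1 / (1 + norm z)\<^sup>2) \<le> norm z * norm (extremal_factor \<alpha> m z)"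
    by (intro mult_left_mono) auto
  then show ?thesis by (simp add: norm_mult)
qed

lemma ex_radius_Koebe_growth_gt:
  fixes a :: real
  assumes a: "a < 1/4"
  obtains s where "0 < s" "s < 1" "\<And>x. s \<le> x \<Longrightarrow> x < 1 \<Longrightarrow> a < x / (1 + x)\<^sup>2"
proof -
  have "((\<lambda>x::real. x / (1 + x)\<^sup>2) \<longlongrightarrow> 1 / (1 + 1)\<^sup>2) (at_left 1)"
    by (intro tendsto_intros) auto
  then have "eventually (\<lambda>x::real. x / (1 + x)\<^sup>2 > a) (at_left 1)"
    using a by (intro order_tendstoD) auto
  then obtain b where b: "b < 1" "\<And>x. b < x \<Longrightarrow> x < 1 \<Longrightarrow> a < x / (1 + x)\<^sup>2"
    using eventually_at_left[of 0 "1::real"] by auto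
  show ?thesis
  proof (rule that)
    show "0 < max (1/2) ((b + 1) / 2)" "max (1/2) ((b + 1) / 2) < 1" using b(1) by auto
    show "a < x / (1 + x)\<^sup>2" if "max (1/2) ((b + 1) / 2) \<le> x" "x < 1" for x
      using b that by (intro b(2)) auto
  qed
qed

text \<open>Sharpness needs the expansion to exist. Rouche is applied on a circle whose radius
  depends on \<open>w\<close>, so the inverse is holomorphic on the whole ball of radius 1/4 and its
  Taylor series converges there.\<close>

lemma extremal_inverse_expansion:
  assumes m: "m \<ge> 1" and \<alpha>: "0 \<le> \<alpha>" "\<alpha> < 1"
  obtains A where "inverse_expansion (\<lambda>z. z * extremal_factor \<alpha> m z) A"
proof -
  define f where "f = (\<lambda>z. z * extremal_factor \<alpha> m z)"
  have f: "f \<in> starlike_of_order \<alpha>" unfolding f_def by (rule extremal_starlike[OF m \<alpha>(2)])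
  then have hol: "f holomorphic_on ball 0 1" and f0: "f 0 = 0" and f': "deriv f 0 = 1"
    by (auto simp: starlike_of_order_def)
  define g where "g = the_inv_into (ball 0 1) f"
  have "\<exists>!z. z \<in> ball 0 1 \<and> f z = w" if w: "w \<in> ball 0 (1/4)" for w
  proof -
    obtain s where s: "0 < s" "s < 1" "\<And>x. s \<le> x \<Longrightarrow> x < 1 \<Longrightarrow> norm w < x / (1 + x)\<^sup>2"
      using ex_radius_Koebe_growth_gt[of "norm w"] w by auto
    show ?thesis
    proof (rule unique_preimage_in_disc[OF hol f0 _ _ s(1,2)])
      fix z :: complex assume "s \<le> norm z" "norm z < 1"
      then show "norm w < norm (f z)"
        using s(3)[of "norm z"] extremal_norm_ge[OF m \<alpha>, of z] by (simp add: f_def)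
    qed (use f' in \<open>auto simp: f_def\<close>)
  qed
  then have "\<forall>w\<in>ball 0 (1/4). \<exists>!z. z \<in> ball 0 1 \<and> f z = w" by blast
  note inv = the_inv_into_holomorphic[OF hol this, folded g_def]
  have "g (f 0) = 0" by (rule inv(2)) (auto simp: f0)
  then have g0: "g 0 = 0" by (simp only: f0)
  \<comment> \<open>Differentiating \<open>g (f z) = z\<close> at 0; together with
    \<open>g 0 = 0\<close> this identifies the terms that \<open>inverse_expansion\<close> splits
    off as \<open>w\<close>.\<close>
  have "deriv f 0 * deriv g 0 = 1"
  proof -
    have "((g \<circ> f) has_field_derivative (deriv g (f 0) * deriv f 0)) (at 0)"
      using holomorphic_derivI[OF hol open_ball, of 0] holomorphic_derivI[OF inv(1) open_ball, of "f 0"] f0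
      by (intro DERIV_chain) auto
    moreover have "eventually (\<lambda>z. f z \<in> ball 0 (1/4)) (nhds 0)"
    proof -
      have "isCont f 0" using hol by (metis centre_in_ball continuous_on_interior holomorphic_on_imp_continuous_on interior_ball zero_less_one)
      then have "(f \<longlongrightarrow> f 0) (nhds 0)" by (simp only: isCont_def tendsto_at_iff_tendsto_nhds)
      then show ?thesis by (rule topological_tendstoD) (use f0 in auto)
    qed
    then have "eventually (\<lambda>z. (g \<circ> f) z = z) (nhds 0)"
      using eventually_in_unit_ball by eventually_elim (use inv(2) in auto)
    ultimately have "((\<lambda>z. z) has_field_derivative (deriv g (f 0) * deriv f 0)) (at 0)"
      using DERIV_cong_ev[of 0 0 "g \<circ> f" "\<lambda>z. z"] by simp
    then show ?thesis using DERIV_unique[OF DERIV_ident] by (metis f0 mult.commute)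
  qed
  then have g': "deriv g 0 = 1" by (simp add: f')
  have "inverse_expansion f (\<lambda>k. (deriv ^^ k) g 0 / fact k)"
    unfolding inverse_expansion_def g_def[symmetric]
  proof
    fix w :: complex assume "w \<in> ball 0 (1/4)"
    from holomorphic_power_series[OF inv(1) this]
    have "(\<lambda>k. (deriv ^^ k) g 0 / fact k * w ^ k) sums g w" by simp
    then show "(\<lambda>k. (deriv ^^ (k + 2)) g 0 / fact (k + 2) * w ^ (k + 2)) sums (g w - w)"
      by (subst sums_iff_shift) (simp add: numeral_2_eq_2 g0 g')
  qed
  then show ?thesis using that by (simp add: f_def)
qed

section \<open>Coefficients of the extremal inverses\<close>

text \<open>For these functions \<open>\<omega> = -z^m\<close>, so the equation for \<open>H\<close>
  becomes a recursion with step \<open>m\<close> upon comparing coefficients.\<close>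

lemma extremal_coeff_ode:
  assumes m: "m \<ge> 1" and E: "extremal_factor \<alpha> m has_fps_expansion E"
  shows "of_nat k * fps_nth (inverse E ^ n) k = 
    (if k < m then 0 else - (of_real (2 * real n * (1 - \<alpha>)) - of_nat (k - m)) * fps_nth (inverse E ^ n) (k - m))"
proof -
  define c where "c = complex_of_real (2 * (1 - \<alpha>))"
  let ?e = "extremal_factor \<alpha> m"
  have E0: "fps_nth E 0 = 1" using has_fps_expansion_imp_0_eq_fps_nth_0[OF E] extremal_factor_0[OF m] by simp
  have "(\<lambda>z. - (z ^ m) * (c * ?e z + z * deriv ?e z)) has_fps_expansion - (fps_X ^ m) * (fps_const c * E + fps_X * fps_deriv E)"
    by (intro fps_expansion_intros E)
  moreover have "(\<lambda>z. - (z * deriv ?e z)) has_fps_expansion - (fps_X * fps_deriv E)"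
    by (intro fps_expansion_intros E)
  moreover have "eventually (\<lambda>z. - (z ^ m) * (c * ?e z + z * deriv ?e z) = - (z * deriv ?e z)) (nhds 0)"
    using eventually_in_unit_ball
  proof eventually_elim
    case (elim z)
    have nz: "1 - z ^ m \<noteq> 0" by (rule one_minus_power_in_slit_plane(2)[OF elim m])
    have d: "z * deriv ?e z = c * z ^ m / (1 - z ^ m) * ?e z"
      unfolding c_def by (rule deriv_extremal_factor[OF m elim])
    show ?case unfolding d using nz by (simp add: field_simps)
  qed
  ultimately have ode: "- (fps_X ^ m) * (fps_const c * E + fps_X * fps_deriv E) = - (fps_X * fps_deriv E)"
    by (rule fps_expansion_eventually_unique)
  define H where "H = inverse E ^ n"
  have \<beta>: "of_nat n * c = complex_of_real (2 * real n * (1 - \<alpha>))" by (simp add: c_def mult_ac)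
  have "fps_X * fps_deriv H = - (fps_X ^ m) * (fps_const (of_real (2 * real n * (1 - \<alpha>))) * H - fps_X * fps_deriv H)"
    using fps_inverse_power_ode[OF _ ode, of n] E0 unfolding H_def \<beta> by simp
  then have "fps_nth (fps_X * fps_deriv H) k
      = fps_nth (- (fps_X ^ m * (fps_const (of_real (2 * real n * (1 - \<alpha>))) * H - fps_X * fps_deriv H))) k"
    by (simp only: mult_minus_left)
  moreover have XH: "fps_nth (fps_X * fps_deriv H) j = of_nat j * fps_nth H j" for j
    by (cases j) simp_all
  ultimately show ?thesis
    unfolding H_def[symmetric] fps_neg_nth fps_X_power_mult_nth fps_sub_nth XH fps_mult_left_const_nth
    by (simp add: algebra_simps)
qed

lemma extremal_inverse_coeff:
  assumes m: "m \<ge> 1" and \<alpha>: "0 \<le> \<alpha>" "\<alpha> < 1" and n: "n \<ge> 2" 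
    and A: "inverse_expansion (\<lambda>z. z * extremal_factor \<alpha> m z) A"
  obtains h where "of_nat n * A n = h (n - 1)" "h 0 = 1" 
    "\<And>k. of_nat k * h k = (if k < m then 0 else - (of_real (2 * real n * (1 - \<alpha>)) - of_nat (k - m)) * h (k - m))"
proof -
  note e = extremal_factor_holomorphic[OF m, of \<alpha>]
  define E where "E = fps_expansion (extremal_factor \<alpha> m) 0"
  have E: "extremal_factor \<alpha> m has_fps_expansion E"
    unfolding E_def by (rule has_fps_expansion_fps_expansion[OF open_ball _ e]) simp
  have "fps_nth E 0 = 1" using has_fps_expansion_imp_0_eq_fps_nth_0[OF E] extremal_factor_0[OF m] by simp
  then have "fps_nth (inverse E ^ n) 0 = 1" by (simp add: fps_nth_power_0)
  moreover have "of_nat n * A n = fps_nth (inverse E ^ n) (n - 1)"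
    by (rule starlike_inverse_coeff[OF extremal_starlike[OF m \<alpha>(2)] \<alpha>(1) A _ e extremal_factor_0[OF m] E n]) simp
  ultimately show ?thesis using that[of "fps_nth (inverse E ^ n)"] extremal_coeff_ode[OF m E] by blast
qed

text \<open>With \<open>m = 1\<close> the recursion is that of the binomial coefficients up to sign.
  The absolute value remains because they can be negative for \<open>\<alpha>\<close> outside the
  range of (a).\<close>

lemma norm_extremal_coeff_binomial:
  assumes \<alpha>: "0 \<le> \<alpha>" "\<alpha> < 1" and n: "n \<ge> 2" 
    and A: "inverse_expansion (\<lambda>z. z * extremal_factor \<alpha> 1 z) A"
  shows "real n * norm (A n) = \<bar>(2 * real n * (1 - \<alpha>)) gchoose (n - 1)\<bar>"
proof -
  define \<beta> where "\<beta> = 2 * real n * (1 - \<alpha>)"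
  obtain h where h: "of_nat n * A n = h (n - 1)" "h 0 = 1" 
    "\<And>k. of_nat k * h k = (if k < 1 then 0 else - (of_real \<beta> - of_nat (k - 1)) * h (k - 1))"
    unfolding \<beta>_def using extremal_inverse_coeff[OF order_refl \<alpha> n A] by metis
  have "norm (h k) = \<bar>\<beta> gchoose k\<bar>" for k
  proof (induction k)
    case (Suc k)
    have "real (Suc k) * norm (h (Suc k)) = norm (of_nat (Suc k) * h (Suc k))" by (simp only: norm_mult norm_of_nat)
    also have "of_nat (Suc k) * h (Suc k) = - of_real (\<beta> - real k) * h k"
      using h(3)[of "Suc k"] by simp
    also have "norm \<dots> = \<bar>\<beta> - real k\<bar> * norm (h k)" by (simp only: norm_mult norm_minus_cancel norm_of_real)
    also have "\<dots> = \<bar>(\<beta> - real k) * (\<beta> gchoose k)\<bar>" by (simp add: Suc abs_mult)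
    also have "(\<beta> - real k) * (\<beta> gchoose k) = real (Suc k) * (\<beta> gchoose Suc k)"
      using gbinomial_absorption[of k \<beta>] gbinomial_absorb_comp[of \<beta> k] by simp
    also have "\<bar>\<dots>\<bar> = real (Suc k) * \<bar>\<beta> gchoose Suc k\<bar>" by (simp only: abs_mult abs_of_nat)
    finally show ?case using mult_left_cancel[of "real (Suc k)"] by (metis of_nat_neq_0)
  qed (simp add: h(2))
  then show ?thesis using h(1) by (metis norm_mult norm_of_nat \<beta>_def)
qed

text \<open>With \<open>m = n - 1\<close> the recursion reaches index \<open>n - 1\<close> from
  \<open>h 0 = 1\<close> in a single step.\<close>

lemma norm_extremal_coeff_top:
  assumes \<alpha>: "0 \<le> \<alpha>" "\<alpha> < 1" and n: "n \<ge> 2" 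
    and A: "inverse_expansion (\<lambda>z. z * extremal_factor \<alpha> (n - 1) z) A"
  shows "norm (A n) = 2 * (1 - \<alpha>) / (real n - 1)"
proof -
  have n1: "n - 1 \<ge> 1" using n by simp
  obtain h where h: "of_nat n * A n = h (n - 1)" "h 0 = 1" 
    "\<And>k. of_nat k * h k = (if k < n - 1 then 0 else - (of_real (2 * real n * (1 - \<alpha>)) - of_nat (k - (n - 1))) * h (k - (n - 1)))"
    using extremal_inverse_coeff[OF n1 \<alpha> n A] by metis
  have "of_nat (n - 1) * (of_nat n * A n) = - complex_of_real (2 * real n * (1 - \<alpha>))"
    using h(3)[of "n - 1"] h(1,2) by simp
  then have "norm (of_nat (n - 1) * (of_nat n * A n)) = \<bar>2 * real n * (1 - \<alpha>)\<bar>"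
    by (simp only: norm_minus_cancel norm_of_real)
  then have "real (n - 1) * (real n * norm (A n)) = 2 * real n * (1 - \<alpha>)"
    using \<alpha> by (simp only: norm_mult norm_of_nat) simp
  then have "(real n - 1) * norm (A n) = 2 * (1 - \<alpha>)" using n by (simp add: of_nat_diff mult.left_commute)
  then show ?thesis using n by (simp add: eq_divide_eq mult.commute)
qed

section \<open>The three estimates and their sharpness\<close>

lemma Gamma_quotient_top:
  fixes \<beta> :: real
  assumes "n \<ge> 2" "\<beta> > real n - 2"
  shows "Gamma (\<beta> + 1) / (Gamma (real n + 1) * Gamma (\<beta> + 2 - real n)) = (\<beta> gchoose (n - 1)) / real n"
proof -
  have D: "\<beta> - real (n - 1) + 1 = \<beta> + 2 - real n" using assms by (simp add: of_nat_diff)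
  have "real (n - 1) * (\<beta> gchoose (n - 1)) = Gamma (\<beta> + 1) / (Gamma (real (n - 1)) * Gamma (\<beta> + 2 - real n))"
    unfolding D[symmetric] using assms by (intro gbinomial_Gamma_top) (auto simp: of_nat_diff)
  moreover have "Gamma (real n + 1) = real n * (real (n - 1) * Gamma (real (n - 1)))"
  proof -
    have "Gamma (real n + 1) = real n * Gamma (real n)" 
      using assms by (intro Gamma_plus1) (auto elim!: nonpos_Ints_cases)
    also have "Gamma (real n) = Gamma (real (n - 1) + 1)" using assms by (simp add: of_nat_diff)
    also have "\<dots> = real (n - 1) * Gamma (real (n - 1))"
      using assms by (intro Gamma_plus1) (auto elim!: nonpos_Ints_cases)
    finally show ?thesis .
  qed
  ultimately have "Gamma (\<beta> + 1) / (Gamma (real n + 1) * Gamma (\<beta> + 2 - real n))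
      = real (n - 1) * (\<beta> gchoose (n - 1)) / (real n * real (n - 1))"
    by (simp del: of_nat_diff)
  then show ?thesis using assms by (simp add: of_nat_diff)
qed

theorem theorem1:
  fixes \<alpha> :: real and n :: nat
  assumes "0 \<le> \<alpha>" and "\<alpha> < 1" and "n \<ge> 2"
  shows
    "(\<forall>f A. f \<in> starlike_of_order \<alpha> \<longrightarrow> inverse_expansion f A \<longrightarrow>
        (\<alpha> \<in> I_interval 0 n \<union> I_interval 1 n \<longrightarrow>
           norm (A n) \<le> Gamma (2 * real n * (1 - \<alpha>) + 1) /
             (Gamma (real n + 1) * Gamma (2 * real n * (1 - \<alpha>) + 2 - real n))) \<and>
        (\<forall>k\<in>{2..n - 2}. \<alpha> \<in> I_interval k n \<longrightarrow>
           norm (A n) \<le> Gamma (2 * real n * (1 - \<alpha>) + 1) /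
             (real n * (real n - 1) * Gamma (real n - real k) *
              Gamma (2 * real n * (1 - \<alpha>) + 1 + real k - real n))) \<and>
        (\<alpha> \<in> I_interval (n - 1) n \<longrightarrow>
           norm (A n) \<le> 2 * (1 - \<alpha>) / (real n - 1))) \<and>
     (\<alpha> \<in> I_interval 0 n \<union> I_interval 1 n \<longrightarrow>
        (\<exists>f\<in>starlike_of_order \<alpha>. \<exists>A. inverse_expansion f A \<and>
           norm (A n) = Gamma (2 * real n * (1 - \<alpha>) + 1) /
             (Gamma (real n + 1) * Gamma (2 * real n * (1 - \<alpha>) + 2 - real n)))) \<and>
     (\<alpha> \<in> I_interval (n - 1) n \<longrightarrow>
        (\<exists>f\<in>starlike_of_order \<alpha>. \<exists>A. inverse_expansion f A \<and>
           norm (A n) = 2 * (1 - \<alpha>) / (real n - 1)))"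
proof -
  define \<beta> where "\<beta> = 2 * real n * (1 - \<alpha>)"
  \<comment> \<open>For \<open>\<alpha>\<close> in the \<open>k\<close>-th interval,
    \<open>n(1 - \<alpha>)\<close> lies in \<open>(n-k-1, n-k]\<close>; thus the integers
    \<open>0 \<le> j < n(1 - \<alpha>)\<close>, those of positive weight, number exactly
    \<open>n - k\<close>.\<close>
  have interval: "real n - real k - 1 < real n * (1 - \<alpha>)" "real n * (1 - \<alpha>) \<le> real n - real k" 
    if "\<alpha> \<in> I_interval k n" for k
  proof -
    have "real k \<le> \<alpha> * real n" "\<alpha> * real n < real k + 1"
      using that assms(3) by (auto simp: I_interval_def divide_le_eq less_divide_eq)
    then show "real n - real k - 1 < real n * (1 - \<alpha>)" "real n * (1 - \<alpha>) \<le> real n - real k"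
      by (simp_all add: algebra_simps)
  qed
  have low: "real n * (1 - \<alpha>) > real n - 2" if "\<alpha> \<in> I_interval 0 n \<union> I_interval 1 n"
    using that interval(1)[of 0] interval(1)[of 1] by auto
  have low\<beta>: "\<beta> > 2 * (real n - 2)" if "\<alpha> \<in> I_interval 0 n \<union> I_interval 1 n"
    using low[OF that] by (simp add: \<beta>_def mult.assoc)
  have Gamma_a: "Gamma (\<beta> + 1) / (Gamma (real n + 1) * Gamma (\<beta> + 2 - real n)) = (\<beta> gchoose (n - 1)) / real n"
    if "\<alpha> \<in> I_interval 0 n \<union> I_interval 1 n"
    using low\<beta>[OF that] assms(3) by (intro Gamma_quotient_top) auto
  show ?thesis
    unfolding \<beta>_def[symmetric]
  proof (intro conjI allI impI ballI)
    fix f A assume f: "f \<in> starlike_of_order \<alpha>" and A: "inverse_expansion f A"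
    note bound = starlike_inverse_coeff_bound[OF f assms(1,2) A assms(3), folded \<beta>_def]
    {
      assume I: "\<alpha> \<in> I_interval 0 n \<union> I_interval 1 n"
      \<comment> \<open>All weights with \<open>j < n - 1\<close> are positive, so nothing is
        dropped and \<open>N = n - 1\<close>.\<close>
      have "norm (A n) \<le> Gamma (\<beta> + 1) / (real n * (real n - 1) * Gamma (real (n - 1)) * Gamma (\<beta> - real (n - 1) + 1))"
        using low\<beta>[OF I] assms(3) by (intro bound) (auto simp: of_nat_diff)
      also have "\<dots> = (Gamma (\<beta> + 1) / (Gamma (real (n - 1)) * Gamma (\<beta> - real (n - 1) + 1))) / (real n * (real n - 1))"
        by simp
      also have "Gamma (\<beta> + 1) / (Gamma (real (n - 1)) * Gamma (\<beta> - real (n - 1) + 1)) = real (n - 1) * (\<beta> gchoose (n - 1))"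
        using low\<beta>[OF I] assms(3) by (intro gbinomial_Gamma_top[symmetric]) (auto simp: of_nat_diff)
      also have "\<dots> / (real n * (real n - 1)) = (\<beta> gchoose (n - 1)) / real n"
        using assms(3) by (simp add: of_nat_diff)
      finally show "norm (A n) \<le> Gamma (\<beta> + 1) / (Gamma (real n + 1) * Gamma (\<beta> + 2 - real n))"
        by (simp only: Gamma_a[OF I])
    }
    {
      fix k assume k: "k \<in> {2..n - 2}" and I: "\<alpha> \<in> I_interval k n"
      have kn: "k \<le> n" using k by auto
      have "norm (A n) \<le> Gamma (\<beta> + 1) / (real n * (real n - 1) * Gamma (real (n - k)) * Gamma (\<beta> - real (n - k) + 1))"
        using k assms(3) interval[OF I] by (intro bound) (auto simp: of_nat_diff[OF kn] \<beta>_def mult.assoc)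
      also have "\<beta> - real (n - k) + 1 = \<beta> + 1 + real k - real n" by (simp add: of_nat_diff[OF kn])
      also have "real (n - k) = real n - real k" by (simp add: of_nat_diff[OF kn])
      finally show "norm (A n) \<le> Gamma (\<beta> + 1) / (real n * (real n - 1) * Gamma (real n - real k) * Gamma (\<beta> + 1 + real k - real n))" .
    }
    {
      assume I: "\<alpha> \<in> I_interval (n - 1) n"
      have pos: "\<beta> > 0" using assms by (simp add: \<beta>_def)
      \<comment> \<open>Now \<open>n(1 - \<alpha>) \<le> 1\<close>, so only the weight at 0 is
        positive and \<open>N = 1\<close>; the Gamma quotient collapses to
        \<open>\<beta> / (n (n - 1))\<close>.\<close>
      have "norm (A n) \<le> Gamma (\<beta> + 1) / (real n * (real n - 1) * Gamma (real 1) * Gamma (\<beta> - real 1 + 1))"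
        using pos assms(3) interval(2)[OF I] by (intro bound) (auto simp: of_nat_diff)
      also have "Gamma (\<beta> + 1) = \<beta> * Gamma \<beta>"
        using pos by (intro Gamma_plus1) (auto elim!: nonpos_Ints_cases)
      also have "\<beta> * Gamma \<beta> / (real n * (real n - 1) * Gamma (real 1) * Gamma (\<beta> - real 1 + 1)) = 2 * (1 - \<alpha>) / (real n - 1)"
        using Gamma_real_pos[OF pos] assms(3) by (simp add: \<beta>_def)
      finally show "norm (A n) \<le> 2 * (1 - \<alpha>) / (real n - 1)" .
    }
  next
    assume I: "\<alpha> \<in> I_interval 0 n \<union> I_interval 1 n"
    obtain A where A: "inverse_expansion (\<lambda>z. z * extremal_factor \<alpha> 1 z) A"
      using extremal_inverse_expansion[OF order_refl assms(1,2)] by blast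
    \<comment> \<open>In the range of (a), \<open>\<beta> > 2(n - 2) \<ge> n - 2\<close>, so every
      factor \<open>\<beta> - i\<close> is nonnegative and the absolute value can be
      removed.\<close>
    have "(\<beta> gchoose (n - 1)) \<ge> 0"
    proof -
      have "(\<Prod>i = 0..<n - 1. \<beta> - real i) \<ge> 0"
        using low\<beta>[OF I] assms(3) by (intro prod_nonneg) auto
      then show ?thesis by (simp add: gbinomial_prod_rev)
    qed
    then have "norm (A n) = (\<beta> gchoose (n - 1)) / real n"
      using norm_extremal_coeff_binomial[OF assms A] assms(3) by (simp add: \<beta>_def eq_divide_eq mult.commute)
    then show "\<exists>f\<in>starlike_of_order \<alpha>. \<exists>A. inverse_expansion f A \<and>
           norm (A n) = Gamma (\<beta> + 1) / (Gamma (real n + 1) * Gamma (\<beta> + 2 - real n))"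
      unfolding Gamma_a[OF I] using A extremal_starlike[OF order_refl assms(2)] by blast
  next
    have n1: "n - 1 \<ge> 1" using assms(3) by simp
    obtain A where A: "inverse_expansion (\<lambda>z. z * extremal_factor \<alpha> (n - 1) z) A"
      using extremal_inverse_expansion[OF n1 assms(1,2)] by blast
    then show "\<exists>f\<in>starlike_of_order \<alpha>. \<exists>A. inverse_expansion f A \<and> norm (A n) = 2 * (1 - \<alpha>) / (real n - 1)"
      using norm_extremal_coeff_top[OF assms A] extremal_starlike[OF n1 assms(2)] by blast
  qed
qed

end
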